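(* Let $f:\mathbb{R}^n\to\mathbb{R}$ be a (possibly non-strongly-convex) function with $L_1$-Lipschitz gradient ($L_1>0$), let $c\in[0,1)$, $\mu>0$, $t\in\mathbb{N}$, $t\ge1$, and assume the variance bound with constant $\sigma^2$ for the zeroth-order oracle stated in the context. Let $$h\in\Bigl(0,\frac{\sqrt{2(1+c^2)}-2c}{2L_1}\Bigr),$$ let $\tilde z_k$ be the zeroth-order regularised gradient descent iterates $\tilde z_{k+1}=c\tilde z_k-h\,g_\mu(\tilde z_k)$ started at a deterministic point, let $\bar z_k=E[\tilde z_k]$, and let $$q_k=h\bigl(\nabla f(\bar z_k)-E[\nabla f_\mu(\tilde z_k)]\bigr),$$ so that $\bar z_{k+1}=c\bar z_k-h\nabla f(\bar z_k)+q_k$. Then $$\sup_k\|q_k\|\le h\,\frac{\mu}{2}L_1(n+3)^{3/2}+hL_1\sqrt{\frac{2h^2\sigma^2}{t(1-c^2-4cL_1h-2L_1^2h^2)}}.$$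
   Context: $\|\cdot\|$ is the Euclidean norm. $f$ is continuously differentiable and bounded below. Lipschitz gradient: $\|\nabla f(x)-\nabla f(y)\|\le L_1\|x-y\|$ for all $x,y$. The iteration $z_{k+1}=cz_k-h\nabla f(z_k)$ is gradient descent with step size $h$ applied to the regularised problem $\min_x f(x)+\lambda\|x\|^2$ with $\lambda=\frac{1-c}{2h}$. Gaussian smoothing: $f_\mu(x)=E_u[f(x+\mu u)]$ with $u\sim\mathcal{N}(0,I_n)$. Two-point oracle: $\frac1\mu(f(x+\mu u)-f(x))u$, whose expectation over $u$ is $\nabla f_\mu(x)$. Variance assumption: for some $\sigma\ge0$, $E_u[\|\frac1\mu(f(x+\mu u)-f(x))u-\nabla f_\mu(x)\|^2]\le\sigma^2$ for all $x$. In the algorithm, at each iteration $g_\mu(x)$ denotes the average of $t$ independent evaluations of the two-point oracle at $x$, with random directions independent of all earlier iterations; thus it is unbiased for $\nabla f_\mu(x)$ and has variance at most $\sigma^2/t$. $E[\cdot]$ denotes expectation over all random directions drawn so far, and $\bar z_0=\tilde z_0$. *)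

theory Defs
  imports "HOL-Probability.Probability"
begin

definition grad :: "(real^'n \<Rightarrow> real) \<Rightarrow> real^'n \<Rightarrow> real^'n" where
  "grad f x = (THE D. GDERIV f x :> D)"

text \<open>The standard normal distribution \<open>N(0, I)\<close>, given by its Lebesgue density
  \<open>(2 pi)^(-n/2) exp (- |u|^2 / 2)\<close> with \<open>n = CARD('n)\<close>.\<close>

definition std_gaussian :: "(real^'n) measure" where
  "std_gaussian = density lborel
     (\<lambda>u. ennreal ((2 * pi) powr (- real CARD('n) / 2) * exp (- (norm u)\<^sup>2 / 2)))"

definition gaussian_smoothing :: "real \<Rightarrow> (real^'n \<Rightarrow> real) \<Rightarrow> real^'n \<Rightarrow> real" where
  "gaussian_smoothing \<mu> f x = (\<integral>u. f (x + \<mu> *\<^sub>R u) \<partial>std_gaussian)"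

definition two_point_oracle ::
    "real \<Rightarrow> (real^'n \<Rightarrow> real) \<Rightarrow> real^'n \<Rightarrow> real^'n \<Rightarrow> real^'n" where
  "two_point_oracle \<mu> f x u = (1 / \<mu> * (f (x + \<mu> *\<^sub>R u) - f x)) *\<^sub>R u"

definition averaged_oracle ::
    "real \<Rightarrow> nat \<Rightarrow> (real^'n \<Rightarrow> real) \<Rightarrow> (nat \<Rightarrow> real^'n) \<Rightarrow> real^'n \<Rightarrow> real^'n" where
  "averaged_oracle \<mu> t f v x = (1 / real t) *\<^sub>R (\<Sum>i<t. two_point_oracle \<mu> f x (v i))"

text \<open>The iterates for one realisation \<open>v\<close> of all random directions:
  \<open>v k i\<close> with \<open>i < t\<close> are the directions drawn in iteration \<open>k\<close>.\<close>

primrec zo_iterate ::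
    "real \<Rightarrow> nat \<Rightarrow> real \<Rightarrow> real \<Rightarrow> (real^'n \<Rightarrow> real) \<Rightarrow> real^'n \<Rightarrow>
     (nat \<Rightarrow> nat \<Rightarrow> real^'n) \<Rightarrow> nat \<Rightarrow> real^'n" where
  "zo_iterate \<mu> t c h f z0 v 0 = z0"
| "zo_iterate \<mu> t c h f z0 v (Suc k) =
     c *\<^sub>R zo_iterate \<mu> t c h f z0 v k
       - h *\<^sub>R averaged_oracle \<mu> t f (v k) (zo_iterate \<mu> t c h f z0 v k)"

end

theory Submission
  imports Defs
begin

text \<open>
  Write \<open>G\<close> for the gradient of the Gaussian smoothing. The averaged oracle at \<open>z\<close> is \<open>G z\<close> plus
  centred noise, so one iteration is \<open>z \<mapsto> B z - h \<eta>\<close> with \<open>B z = c z - h G z\<close> and \<open>\<eta>\<close> centred given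
  the past. Hence the mean of the iterates satisfies the recursion with \<open>E[G(z_k)]\<close> in place of the
  gradient of \<open>f\<close> at the mean, and \<open>q_k\<close> is \<open>h\<close> times the difference of these two vectors. With \<open>m_k\<close>
  for the mean, the difference splits into \<open>grad f(m_k) - G(m_k)\<close> and \<open>G(m_k) - E[G(z_k)]\<close>.

  The first part is the smoothing bias. Since \<open>G x\<close> is the Gaussian average of \<open>grad f (x + \<mu> u)\<close>, it
  is at most \<open>\<mu> L E|u|\<close>, and \<open>E|u| \<le> (1 + n) / 2\<close> already lies below \<open>(n + 3)^(3/2) / 2\<close>
  (\<open>grad_gaussian_smoothing_bias\<close>).

  The second part is controlled by the dispersion \<open>V_k = E|z_k - m_k|^2\<close>: averages inherit the
  Lipschitz constant \<open>L\<close>, so by Jensen it is at most \<open>L sqrt V_k\<close>. To bound \<open>V_k\<close>, compare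
  \<open>z_(k+1)\<close> with \<open>B m_k\<close> instead of with its own mean, which can only increase the mean square.
  The noise terms are orthogonal to each other and to everything that the past determines, and \<open>B\<close>
  is \<open>(c + h L)\<close>-Lipschitz, so \<open>V_(k+1) \<le> (c + h L)^2 V_k + h^2 \<sigma>^2 / t\<close> (\<open>dispersion_Suc\<close>). The
  bound on \<open>h\<close> says exactly that \<open>2 (c + h L)^2 < 1 + c^2\<close>. Hence the recursion contracts, and as
  \<open>V_0 = 0\<close>, \<open>V_k\<close> stays below the fixed point \<open>h^2 \<sigma>^2 / (t (1 - (c + h L)^2))\<close>, which is at most
  the expression under the square root in the claim.

  The analytic input is the identity of the mean of the oracle with \<open>G\<close>, i.e. Gaussian integration
  by parts (\<open>std_gaussian_stein\<close>); it follows from the translation invariance of Lebesgue measure.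
  The probabilistic input is that a fresh direction is independent of the past, so that the
  properties of the oracle at a fixed point carry over to the oracle at a random iterate by Fubini
  (\<open>conditional_mean_square_le\<close>, \<open>conditionally_centred_orthogonal\<close>).
\<close>

section \<open>Integration against the standard Gaussian\<close>

lemma norm_sq_eq_sum_Basis: "(norm u)\<^sup>2 = (\<Sum>b\<in>Basis. (u \<bullet> b)\<^sup>2)"
  unfolding power2_norm_eq_inner by (subst euclidean_inner) (simp add: power2_eq_square)

text \<open>The integrand is a product over the coordinates, which reduces the claim to the density of a
  one-dimensional normal distribution of variance \<open>1 / (2 a)\<close>.\<close>

lemma integrable_exp_neg_norm_sq:
  fixes a :: real
  assumes "a > 0"
  shows "integrable lborel (\<lambda>u::'a::euclidean_space. exp (- a * (norm u)\<^sup>2))"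
proof -
  have fin: "(\<integral>\<^sup>+x. ennreal (exp (- a * x\<^sup>2)) \<partial>lborel) < \<infinity>"
  proof -
    define s where "s = 1 / sqrt (2 * a)"
    have s: "s > 0" "s\<^sup>2 = 1 / (2 * a)"
      using assms by (auto simp: s_def power_divide)
    have "integrable lborel (\<lambda>x::real. sqrt (2 * pi * s\<^sup>2) * normal_density 0 s x)"
      using s by (intro integrable_mult_right) simp
    moreover have "sqrt (2 * pi * s\<^sup>2) * normal_density 0 s x = exp (- a * x\<^sup>2)" for x
      using s assms by (simp add: normal_density_def)
    ultimately have "integrable lborel (\<lambda>x::real. exp (- a * x\<^sup>2))" by simp
    then show ?thesis by (simp add: integrable_iff_bounded)
  qed
  have "(\<integral>\<^sup>+u. ennreal (exp (- a * (norm (u::'a))\<^sup>2)) \<partial>lborel)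
      = (\<integral>\<^sup>+u. (\<Prod>b\<in>Basis. ennreal (exp (- a * ((u::'a) \<bullet> b)\<^sup>2))) \<partial>lborel)"
  proof (rule nn_integral_cong)
    fix u :: 'a
    have "- a * (norm u)\<^sup>2 = (\<Sum>b\<in>Basis. - a * (u \<bullet> b)\<^sup>2)"
      by (simp add: norm_sq_eq_sum_Basis sum_distrib_left sum_negf)
    then show "ennreal (exp (- a * (norm u)\<^sup>2)) = (\<Prod>b\<in>Basis. ennreal (exp (- a * (u \<bullet> b)\<^sup>2)))"
      by (simp only: exp_sum finite_Basis prod_ennreal exp_ge_zero)
  qed
  also have "\<dots> = (\<Prod>b\<in>(Basis::'a set). \<integral>\<^sup>+x. ennreal (exp (- a * x\<^sup>2)) \<partial>lborel)"
    by (rule nn_integral_lborel_prod) auto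
  also have "\<dots> < \<infinity>"
    using fin by (simp add: power_less_top_ennreal)
  finally show ?thesis by (simp add: integrable_iff_bounded)
qed

lemma prob_space_std_gaussian: "prob_space (std_gaussian :: (real^'n) measure)"
proof
  have "(2 * pi) powr (- real CARD('n) / 2) * exp (- (norm u)\<^sup>2 / 2)
      = (\<Prod>b\<in>Basis. std_normal_density (u \<bullet> b))" for u :: "real^'n"
  proof -
    have "(\<Prod>b\<in>Basis. std_normal_density (u \<bullet> b))
        = (1 / sqrt (2 * pi)) ^ CARD('n) * exp (\<Sum>b\<in>Basis. - (u \<bullet> b)\<^sup>2 / 2)"
      by (simp add: std_normal_density_def exp_sum prod_dividef power_one_over)
    also have "(\<Sum>b\<in>Basis. - (u \<bullet> b)\<^sup>2 / 2) = - (norm u)\<^sup>2 / 2"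
      by (simp add: norm_sq_eq_sum_Basis sum_negf sum_divide_distrib)
    also have "(1 / sqrt (2 * pi)) ^ CARD('n) = (2 * pi) powr (- real CARD('n) / 2)"
    proof -
      have "1 / sqrt (2 * pi) = (2 * pi) powr (- 1 / 2)"
        by (simp add: powr_half_sqrt[symmetric] powr_minus_divide)
      then have "(1 / sqrt (2 * pi)) ^ CARD('n) = ((2 * pi) powr (- 1 / 2)) powr real CARD('n)"
        by (simp add: powr_realpow)
      then show ?thesis by (simp add: powr_powr)
    qed
    finally show ?thesis by simp
  qed
  then have "emeasure (std_gaussian :: (real^'n) measure) (space std_gaussian)
      = (\<integral>\<^sup>+u. (\<Prod>b\<in>Basis. ennreal (std_normal_density ((u::real^'n) \<bullet> b))) \<partial>lborel)"
    by (simp add: std_gaussian_def emeasure_density prod_ennreal)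
  also have "\<dots> = (\<Prod>b\<in>(Basis::(real^'n) set). \<integral>\<^sup>+x. ennreal (std_normal_density x) \<partial>lborel)"
    by (rule nn_integral_lborel_prod) auto
  also have "\<dots> = 1"
    by (simp add: nn_integral_eq_integral)
  finally show "emeasure (std_gaussian :: (real^'n) measure) (space std_gaussian) = 1" .
qed

lemma sets_std_gaussian [simp, measurable_cong]: "sets std_gaussian = sets borel"
  by (simp add: std_gaussian_def)

lemma space_std_gaussian [simp]: "space std_gaussian = UNIV"
  by (simp add: std_gaussian_def)

text \<open>From \<open>1 + r \<le> exp r\<close> and \<open>k r \<le> k\<^sup>2 + r\<^sup>2 / 4\<close>. With this explicit constant, all dominating
  functions below can be taken to be multiples of Gaussians of larger variance.\<close>

lemma power_le_exp_square:
  fixes r :: real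
  assumes "r \<ge> 0"
  shows "(1 + r) ^ k \<le> exp ((real k)\<^sup>2) * exp (r\<^sup>2 / 4)"
proof -
  have "(1 + r) ^ k \<le> exp r ^ k"
    using assms by (intro power_mono) auto
  also have "\<dots> = exp (real k * r)"
    by (simp add: exp_of_nat_mult)
  also have "real k * r \<le> (real k)\<^sup>2 + r\<^sup>2 / 4"
    using zero_le_power2[of "real k - r / 2"] by (simp add: power2_diff power_divide)
  finally show ?thesis by (simp add: exp_add)
qed

lemma poly_times_gaussian_le:
  fixes y :: "'a::real_normed_vector"
  assumes "C \<ge> 0"
  shows "C * (1 + norm y) ^ k * exp (- (norm y)\<^sup>2 / 2)
    \<le> C * exp ((real k)\<^sup>2) * exp (- (1 / 4) * (norm y)\<^sup>2)"
proof -
  have "C * (1 + norm y) ^ k * exp (- (norm y)\<^sup>2 / 2)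
      \<le> C * (exp ((real k)\<^sup>2) * exp ((norm y)\<^sup>2 / 4)) * exp (- (norm y)\<^sup>2 / 2)"
    using assms by (intro mult_right_mono mult_left_mono power_le_exp_square) auto
  also have "\<dots> = C * exp ((real k)\<^sup>2) * exp (- (1 / 4) * (norm y)\<^sup>2)"
    by (simp add: mult.assoc flip: exp_add)
  finally show ?thesis .
qed

lemma integrable_poly_times_gaussian:
  fixes f :: "'a::euclidean_space \<Rightarrow> 'b::{banach, second_countable_topology}"
  assumes [measurable]: "f \<in> borel_measurable borel"
    and bound: "\<And>u. norm (f u) \<le> C * (1 + norm u) ^ k"
  shows "integrable lborel (\<lambda>u. exp (- (norm u)\<^sup>2 / 2) *\<^sub>R f u)"
proof (rule Bochner_Integration.integrable_bound)
  show "integrable lborel (\<lambda>u::'a. C * exp ((real k)\<^sup>2) * exp (- (1 / 4) * (norm u)\<^sup>2))"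
    by (intro integrable_mult_right integrable_exp_neg_norm_sq) simp
  have "C \<ge> 0" using order_trans[OF norm_ge_zero bound[of 0]] by simp
  have "norm (exp (- (norm u)\<^sup>2 / 2) *\<^sub>R f u)
      \<le> C * exp ((real k)\<^sup>2) * exp (- (1 / 4) * (norm u)\<^sup>2)" for u
  proof -
    have "norm (exp (- (norm u)\<^sup>2 / 2) *\<^sub>R f u) = norm (f u) * exp (- (norm u)\<^sup>2 / 2)"
      by simp
    also have "\<dots> \<le> C * (1 + norm u) ^ k * exp (- (norm u)\<^sup>2 / 2)"
      by (intro mult_right_mono bound) simp
    also have "\<dots> \<le> C * exp ((real k)\<^sup>2) * exp (- (1 / 4) * (norm u)\<^sup>2)"
      by (rule poly_times_gaussian_le) fact
    finally show ?thesis .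
  qed
  then show "AE u in lborel. norm (exp (- (norm u)\<^sup>2 / 2) *\<^sub>R f u)
      \<le> norm (C * exp ((real k)\<^sup>2) * exp (- (1 / 4) * (norm u)\<^sup>2))"
    by (intro AE_I2 order_trans[OF _ abs_ge_self[where 'a = real, folded real_norm_def]])
qed simp

lemma integrable_std_gaussian_poly:
  fixes f :: "real^'n \<Rightarrow> 'b::{banach, second_countable_topology}"
  assumes [measurable]: "f \<in> borel_measurable borel"
    and bound: "\<And>u. norm (f u) \<le> C * (1 + norm u) ^ k"
  shows "integrable std_gaussian f"
  using integrable_poly_times_gaussian[OF assms]
  by (simp add: std_gaussian_def integrable_density flip: scaleR_scaleR)

lemma integral_std_gaussian:
  fixes f :: "real^'n \<Rightarrow> 'b::{banach, second_countable_topology}"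
  assumes "f \<in> borel_measurable borel"
  shows "(\<integral>u. f u \<partial>std_gaussian)
    = (2 * pi) powr (- real CARD('n) / 2) *\<^sub>R (\<integral>u. exp (- (norm u)\<^sup>2 / 2) *\<^sub>R f u \<partial>lborel)"
  using assms by (simp add: std_gaussian_def integral_density flip: scaleR_scaleR)

lemma lborel_integral_translate:
  fixes f :: "'a::euclidean_space \<Rightarrow> real"
  assumes [measurable]: "f \<in> borel_measurable borel"
  shows "(\<integral>u. f (u + a) \<partial>lborel) = (\<integral>u. f u \<partial>lborel)"
    and "integrable lborel f \<Longrightarrow> integrable lborel (\<lambda>u. f (u + a))"
proof -
  have "(\<integral>u. f u \<partial>lborel) = (\<integral>u. f u \<partial>distr lborel borel ((+) a))"
    by (simp add: lborel_distr_plus)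
  also have "\<dots> = (\<integral>u. f (a + u) \<partial>lborel)"
    by (rule integral_distr) auto
  finally show "(\<integral>u. f (u + a) \<partial>lborel) = (\<integral>u. f u \<partial>lborel)"
    by (simp add: add.commute)
  assume "integrable lborel f"
  then have "integrable (distr lborel borel ((+) a)) f"
    by (simp add: lborel_distr_plus)
  then show "integrable lborel (\<lambda>u. f (u + a))"
    by (subst (asm) integrable_distr_eq) (auto simp: add.commute)
qed

lemma GDERIV_continuous_on:
  assumes "\<And>x. GDERIV f x :> D x"
  shows "continuous_on UNIV f"
  by (intro continuous_at_imp_continuous_on ballI has_derivative_continuous)
     (rule assms[unfolded gderiv_def])

lemma GDERIV_line:
  assumes "GDERIV f (x + s *\<^sub>R d) :> D"
  shows "((\<lambda>s. f (x + s *\<^sub>R d)) has_real_derivative D \<bullet> d) (at s)"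
proof -
  have "((\<lambda>s. x + s *\<^sub>R d) has_derivative (\<lambda>s. s *\<^sub>R d)) (at s)"
    by (auto intro!: derivative_eq_intros)
  from has_derivative_compose[OF this assms[unfolded gderiv_def]]
  show ?thesis
    by (simp add: has_field_derivative_def inner_commute mult_commute_abs)
qed

section \<open>Gaussian integration by parts\<close>

text \<open>Let \<open>F\<close> be \<open>g\<close> times the unnormalised density. The difference quotients of \<open>F\<close> in direction \<open>e\<close>
  integrate to zero, because Lebesgue measure is translation invariant. They converge to the
  directional derivative of \<open>F\<close>, whose two terms are the two sides of the claim.\<close>

lemma std_gaussian_stein:
  fixes g :: "real^'n \<Rightarrow> real"
  assumes g: "\<And>u. GDERIV g u :> g' u"
    and [measurable]: "g' \<in> borel_measurable borel"
    and bound_g: "\<And>u. \<bar>g u\<bar> \<le> C * (1 + norm u) ^ k"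
    and bound_g': "\<And>u. norm (g' u) \<le> C * (1 + norm u) ^ k"
  shows "(\<integral>u. g u * (u \<bullet> e) \<partial>std_gaussian) = (\<integral>u. g' u \<bullet> e \<partial>std_gaussian)"
proof -
  have [measurable]: "g \<in> borel_measurable borel"
    by (rule borel_measurable_continuous_onI[OF GDERIV_continuous_on]) (rule g)
  define \<phi> :: "real^'n \<Rightarrow> real" where "\<phi> u = exp (- (norm u)\<^sup>2 / 2)" for u
  define F where "F u = \<phi> u * g u" for u
  define dF where "dF u = \<phi> u * (g' u \<bullet> e) - \<phi> u * (g u * (u \<bullet> e))" for u
  have [measurable]: "\<phi> \<in> borel_measurable borel" "F \<in> borel_measurable borel"
      "dF \<in> borel_measurable borel"
    unfolding \<phi>_def F_def dF_def by auto
  have C: "C \<ge> 0" using order_trans[OF abs_ge_zero bound_g[of 0]] by simp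

  have F_deriv: "((\<lambda>s. F (u + s *\<^sub>R e)) has_real_derivative dF (u + s *\<^sub>R e)) (at s)" for u s
  proof -
    have "GDERIV \<phi> y :> - \<phi> y *\<^sub>R y" for y
      unfolding \<phi>_def gderiv_def power2_norm_eq_inner
      by (auto intro!: derivative_eq_intros simp: fun_eq_iff inner_commute)
    from GDERIV_line[OF this[of "u + s *\<^sub>R e"]]
    have "((\<lambda>s. \<phi> (u + s *\<^sub>R e)) has_real_derivative
        - ((u + s *\<^sub>R e) \<bullet> e) * \<phi> (u + s *\<^sub>R e)) (at s)"
      by (simp add: mult.commute)
    from DERIV_mult[OF this GDERIV_line[OF g]] show ?thesis
      by (simp add: F_def dF_def algebra_simps)
  qed

  define K where "K = 2 * C * norm e * exp ((real (Suc k))\<^sup>2)"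
  have bound_1: "\<bar>g' y \<bullet> e\<bar> \<le> C * norm e * (1 + norm y) ^ Suc k" for y
  proof -
    have "\<bar>g' y \<bullet> e\<bar> \<le> C * (1 + norm y) ^ k * norm e"
      by (intro order_trans[OF Cauchy_Schwarz_ineq2] mult_right_mono bound_g') auto
    also have "\<dots> \<le> C * (1 + norm y) ^ Suc k * norm e"
      using C by (intro mult_right_mono mult_left_mono power_increasing) auto
    finally show ?thesis by (simp add: mult_ac)
  qed
  have bound_2: "\<bar>g y * (y \<bullet> e)\<bar> \<le> C * norm e * (1 + norm y) ^ Suc k" for y
  proof -
    have "\<bar>g y * (y \<bullet> e)\<bar> \<le> (C * (1 + norm y) ^ k) * (norm y * norm e)"
      unfolding abs_mult using C
      by (intro mult_mono bound_g Cauchy_Schwarz_ineq2) auto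
    also have "\<dots> \<le> (C * (1 + norm y) ^ k) * ((1 + norm y) * norm e)"
      using C by (intro mult_left_mono mult_right_mono) auto
    finally show ?thesis by (simp add: mult_ac)
  qed
  have dF_bound: "\<bar>dF y\<bar> \<le> K * exp (- (1 / 4) * (norm y)\<^sup>2)" for y
  proof -
    have "\<bar>dF y\<bar> = \<phi> y * \<bar>g' y \<bullet> e - g y * (y \<bullet> e)\<bar>"
      by (simp add: dF_def \<phi>_def abs_mult right_diff_distrib[symmetric])
    also have "\<dots> \<le> \<phi> y * (2 * C * norm e * (1 + norm y) ^ Suc k)"
      using bound_1[of y] bound_2[of y] by (intro mult_left_mono) (auto simp: \<phi>_def)
    also have "\<dots> \<le> K * exp (- (1 / 4) * (norm y)\<^sup>2)"
      using poly_times_gaussian_le[of "2 * C * norm e" y "Suc k"] C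
      by (simp add: \<phi>_def K_def mult_ac)
    finally show ?thesis .
  qed

  have int_F: "integrable lborel F"
    using integrable_poly_times_gaussian[of g C k] bound_g by (simp add: F_def[abs_def] \<phi>_def)

  define s where "s n = 1 / real (Suc n)" for n
  have s: "0 < s n" "s n \<le> 1" for n by (auto simp: s_def)
  have s_lim: "s \<longlonglongrightarrow> 0"
    unfolding s_def using LIMSEQ_inverse_real_of_nat by (simp add: inverse_eq_divide)
  define D where "D n u = (F (u + s n *\<^sub>R e) - F u) / s n" for n u
  have lim: "(\<lambda>n. \<integral>u. D n u \<partial>lborel) \<longlonglongrightarrow> (\<integral>u. dF u \<partial>lborel)"
  proof (rule integral_dominated_convergence)
    \<comment> \<open>A point at distance at most \<open>|e|\<close> from \<open>u\<close> may be closer to the origin than \<open>u\<close>; passing from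
      variance 2 to variance 4 pays for this, as \<open>|u|\<^sup>2 \<le> 2 |y|\<^sup>2 + 2 |u - y|\<^sup>2\<close>.\<close>
    show "integrable lborel (\<lambda>u::real^'n. K * exp ((norm e)\<^sup>2 / 4) * exp (- (1 / 8) * (norm u)\<^sup>2))"
      by (intro integrable_mult_right integrable_exp_neg_norm_sq) simp
    show "AE u in lborel. (\<lambda>n. D n u) \<longlonglongrightarrow> dF u"
    proof (rule AE_I2)
      fix u
      have "((\<lambda>s. (F (u + s *\<^sub>R e) - F u) / s) \<longlongrightarrow> dF u) (at 0)"
        using F_deriv[of u 0] by (simp add: DERIV_def)
      then show "(\<lambda>n. D n u) \<longlonglongrightarrow> dF u"
        unfolding D_def
        by (rule filterlim_compose) (use s s_lim in \<open>auto simp: filterlim_at intro!: always_eventually dest: less_imp_neq[symmetric]\<close>)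
    qed
    fix n
    show "AE u in lborel. norm (D n u) \<le> K * exp ((norm e)\<^sup>2 / 4) * exp (- (1 / 8) * (norm u)\<^sup>2)"
    proof (rule AE_I2)
      fix u
      obtain \<theta> where \<theta>: "0 < \<theta>" "\<theta> < s n"
        "F (u + s n *\<^sub>R e) - F (u + 0 *\<^sub>R e) = (s n - 0) * dF (u + \<theta> *\<^sub>R e)"
        using MVT2[of 0 "s n" "\<lambda>s. F (u + s *\<^sub>R e)" "\<lambda>s. dF (u + s *\<^sub>R e)"] F_deriv s by blast
      then have D: "D n u = dF (u + \<theta> *\<^sub>R e)"
        using s[of n] by (simp add: D_def)
      have "norm (\<theta> *\<^sub>R e) \<le> norm e"
        using \<theta> s[of n] by (simp add: mult_left_le_one_le)
      moreover have "norm u \<le> norm (u + \<theta> *\<^sub>R e) + norm (\<theta> *\<^sub>R e)"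
        by (metis add_diff_cancel_right' norm_triangle_ineq4)
      ultimately have "(norm u)\<^sup>2 \<le> (norm (u + \<theta> *\<^sub>R e) + norm e)\<^sup>2"
        by (intro power_mono) auto
      also have "\<dots> \<le> 2 * (norm (u + \<theta> *\<^sub>R e))\<^sup>2 + 2 * (norm e)\<^sup>2"
        using zero_le_power2[of "norm (u + \<theta> *\<^sub>R e) - norm e"] by (simp add: power2_sum power2_diff)
      finally have "exp (- (1 / 4) * (norm (u + \<theta> *\<^sub>R e))\<^sup>2)
          \<le> exp ((norm e)\<^sup>2 / 4) * exp (- (1 / 8) * (norm u)\<^sup>2)"
        by (simp flip: exp_add)
      then have "K * exp (- (1 / 4) * (norm (u + \<theta> *\<^sub>R e))\<^sup>2)
          \<le> K * (exp ((norm e)\<^sup>2 / 4) * exp (- (1 / 8) * (norm u)\<^sup>2))"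
        using C by (intro mult_left_mono) (auto simp: K_def)
      with dF_bound[of "u + \<theta> *\<^sub>R e"]
      show "norm (D n u) \<le> K * exp ((norm e)\<^sup>2 / 4) * exp (- (1 / 8) * (norm u)\<^sup>2)"
        by (simp add: D mult.assoc)
    qed
  qed (simp_all add: D_def)
  have "(\<integral>u. D n u \<partial>lborel) = 0" for n
    using lborel_integral_translate[of F "s n *\<^sub>R e"] int_F by (simp add: D_def)
  with lim have zero: "(\<integral>u. dF u \<partial>lborel) = 0"
    by (simp add: LIMSEQ_const_iff)

  have "integrable lborel (\<lambda>u. \<phi> u * (g' u \<bullet> e))"
    using integrable_poly_times_gaussian[of "\<lambda>u. g' u \<bullet> e" "C * norm e" "Suc k"] bound_1
    by (simp add: \<phi>_def)
  moreover have "integrable lborel (\<lambda>u. \<phi> u * (g u * (u \<bullet> e)))"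
    using integrable_poly_times_gaussian[of "\<lambda>u. g u * (u \<bullet> e)" "C * norm e" "Suc k"] bound_2
    by (simp add: \<phi>_def)
  ultimately show ?thesis
    using zero by (simp add: integral_std_gaussian dF_def[abs_def] \<phi>_def)
qed

text \<open>Integration by parts for the coordinate functions \<open>u \<mapsto> u \<bullet> b\<close>.\<close>

lemma std_gaussian_second_moment:
  shows "integrable std_gaussian (\<lambda>u::real^'n. (norm u)\<^sup>2)"
    and "(\<integral>u. (norm (u::real^'n))\<^sup>2 \<partial>std_gaussian) = real CARD('n)"
proof -
  interpret prob_space "std_gaussian :: (real^'n) measure" by (rule prob_space_std_gaussian)
  have coord: "integrable std_gaussian (\<lambda>u. (u \<bullet> b)\<^sup>2) \<and> (\<integral>u. (u \<bullet> b)\<^sup>2 \<partial>std_gaussian) = 1"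
    if b: "b \<in> Basis" for b :: "real^'n"
  proof
    have ub: "\<bar>u \<bullet> b\<bar> \<le> norm u" for u
      using Cauchy_Schwarz_ineq2[of u b] b by simp
    show "integrable std_gaussian (\<lambda>u. (u \<bullet> b)\<^sup>2)"
    proof (rule integrable_std_gaussian_poly)
      show "norm ((u \<bullet> b)\<^sup>2) \<le> 1 * (1 + norm u)\<^sup>2" for u
        using power_mono[of "\<bar>u \<bullet> b\<bar>" "1 + norm u" 2] ub[of u] by simp
    qed simp
    have "(\<integral>u. (u \<bullet> b) * (u \<bullet> b) \<partial>std_gaussian) = (\<integral>u. b \<bullet> b \<partial>(std_gaussian :: (real^'n) measure))"
    proof (rule std_gaussian_stein)
      show "GDERIV (\<lambda>u. u \<bullet> b) u :> b" for u
        unfolding gderiv_def by (auto intro!: derivative_eq_intros)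
      show "\<bar>u \<bullet> b\<bar> \<le> 1 * (1 + norm u) ^ 1" for u
        using ub[of u] by simp
      show "norm b \<le> 1 * (1 + norm u) ^ 1" for u :: "real^'n"
        using b by simp
    qed simp
    also have "\<dots> = 1"
      using b prob_space by (simp add: inner_same_Basis)
    finally show "(\<integral>u. (u \<bullet> b)\<^sup>2 \<partial>std_gaussian) = 1"
      by (simp add: power2_eq_square)
  qed
  show "integrable std_gaussian (\<lambda>u::real^'n. (norm u)\<^sup>2)"
    using coord by (simp add: norm_sq_eq_sum_Basis)
  show "(\<integral>u. (norm (u::real^'n))\<^sup>2 \<partial>std_gaussian) = real CARD('n)"
    using coord by (simp add: norm_sq_eq_sum_Basis)
qed

section \<open>Smoothing a function with Lipschitz gradient\<close>

lemma grad_eqI: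
  assumes "GDERIV f x :> D"
  shows "grad f x = D"
  unfolding grad_def
proof (rule the_equality)
  fix D' assume "GDERIV f x :> D'"
  with assms have "(\<lambda>h. h \<bullet> D') = (\<lambda>h. h \<bullet> D)"
    unfolding gderiv_def by (rule has_derivative_unique[rotated])
  then show "D' = D"
    by (metis vector_eq_ldot)
qed fact

text \<open>The gradient is the adjoint of the derivative, applied to \<open>1\<close>.\<close>

lemma GDERIV_grad:
  assumes "f differentiable (at x)"
  shows "GDERIV f x :> grad f x"
proof -
  obtain f' where f': "(f has_derivative f') (at x)"
    using assms by (auto simp: differentiable_def)
  then have "linear f'" by (rule has_derivative_linear)
  then have "f' = (\<lambda>h. h \<bullet> adjoint f' 1)"
    by (simp add: fun_eq_iff adjoint_works)
  with f' have "GDERIV f x :> adjoint f' 1"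
    unfolding gderiv_def by metis
  with grad_eqI[OF this] show ?thesis by simp
qed

locale lipschitz_gradient =
  fixes f :: "real^'n \<Rightarrow> real" and df :: "real^'n \<Rightarrow> real^'n" and L :: real
  assumes GDERIV_f: "GDERIV f x :> df x"
    and df_lipschitz: "norm (df x - df y) \<le> L * norm (x - y)"
    and L_nonneg: "L \<ge> 0"
begin

lemma continuous_df: "continuous_on UNIV df"
proof (rule lipschitz_on_continuous_on)
  show "L-lipschitz_on UNIV df"
    using df_lipschitz L_nonneg by (auto simp: lipschitz_on_def dist_norm)
qed

lemma df_measurable [measurable]: "df \<in> borel_measurable borel"
  by (rule borel_measurable_continuous_onI[OF continuous_df])

lemma f_measurable [measurable]: "f \<in> borel_measurable borel"
  by (rule borel_measurable_continuous_onI[OF GDERIV_continuous_on[OF GDERIV_f]])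

text \<open>The mean value theorem on the segment from \<open>x\<close> to \<open>x + d\<close>. The constant is not optimal; only
  the quadratic order is used, for growth bounds and for differentiation under the integral.\<close>

lemma linearisation_error: "\<bar>f (x + d) - f x - df x \<bullet> d\<bar> \<le> L * (norm d)\<^sup>2"
proof -
  obtain \<theta> where \<theta>: "0 < \<theta>" "\<theta> < 1" and eq:
    "f (x + 1 *\<^sub>R d) - f (x + 0 *\<^sub>R d) = (1 - 0) * (df (x + \<theta> *\<^sub>R d) \<bullet> d)"
    using MVT2[of 0 1 "\<lambda>s. f (x + s *\<^sub>R d)" "\<lambda>s. df (x + s *\<^sub>R d) \<bullet> d"]
      GDERIV_line[OF GDERIV_f] by auto
  have "\<bar>f (x + d) - f x - df x \<bullet> d\<bar> = \<bar>(df (x + \<theta> *\<^sub>R d) - df x) \<bullet> d\<bar>"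
    using eq by (simp add: inner_diff_left)
  also have "\<dots> \<le> norm (df (x + \<theta> *\<^sub>R d) - df x) * norm d"
    by (rule Cauchy_Schwarz_ineq2)
  also have "\<dots> \<le> (L * norm (\<theta> *\<^sub>R d)) * norm d"
    using df_lipschitz[of "x + \<theta> *\<^sub>R d" x] by (intro mult_right_mono) auto
  also have "\<dots> \<le> (L * norm d) * norm d"
    using \<theta> L_nonneg by (intro mult_right_mono mult_left_mono) (auto simp: mult_left_le_one_le)
  finally show ?thesis by (simp add: power2_eq_square mult.assoc)
qed

end

context lipschitz_gradient begin

context
  fixes \<mu> :: real and x :: "real^'n"
begin

text \<open>A common constant for the growth in \<open>u\<close> of the difference quotient of \<open>f\<close> and of its gradient.\<close>

definition "growth_const = norm (df x) + L * \<bar>\<mu>\<bar>"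

lemma growth_const_nonneg: "0 \<le> growth_const"
  using L_nonneg by (simp add: growth_const_def)

lemma difference_growth: "\<bar>f (x + \<mu> *\<^sub>R u) - f x\<bar> \<le> \<bar>\<mu>\<bar> * (growth_const * (1 + norm u)\<^sup>2)"
proof -
  have "\<bar>f (x + \<mu> *\<^sub>R u) - f x\<bar> \<le> \<bar>df x \<bullet> (\<mu> *\<^sub>R u)\<bar> + L * (norm (\<mu> *\<^sub>R u))\<^sup>2"
    using linearisation_error[of x "\<mu> *\<^sub>R u"] by linarith
  also have "\<dots> \<le> norm (df x) * norm (\<mu> *\<^sub>R u) + L * (norm (\<mu> *\<^sub>R u))\<^sup>2"
    by (intro add_right_mono Cauchy_Schwarz_ineq2)
  also have "\<dots> = \<bar>\<mu>\<bar> * (norm (df x) * norm u + (L * \<bar>\<mu>\<bar>) * (norm u)\<^sup>2)"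
    by (simp add: power2_eq_square algebra_simps)
  also have "\<dots> \<le> \<bar>\<mu>\<bar> * (norm (df x) * (1 + norm u)\<^sup>2 + (L * \<bar>\<mu>\<bar>) * (1 + norm u)\<^sup>2)"
    using L_nonneg
    by (intro mult_left_mono add_mono) (auto simp: power2_eq_square algebra_simps)
  finally show ?thesis by (simp add: growth_const_def algebra_simps)
qed

lemma gradient_growth: "norm (df (x + \<mu> *\<^sub>R u)) \<le> growth_const * (1 + norm u)\<^sup>2"
proof -
  have "norm (df (x + \<mu> *\<^sub>R u)) \<le> norm (df x) + norm (df (x + \<mu> *\<^sub>R u) - df x)"
    by (metis norm_triangle_sub)
  also have "\<dots> \<le> norm (df x) * 1 + (L * \<bar>\<mu>\<bar>) * norm u"
    using df_lipschitz[of "x + \<mu> *\<^sub>R u" x] by simp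
  also have "\<dots> \<le> norm (df x) * (1 + norm u)\<^sup>2 + (L * \<bar>\<mu>\<bar>) * (1 + norm u)\<^sup>2"
    using L_nonneg
    by (intro add_mono mult_left_mono) (auto simp: power2_eq_square algebra_simps)
  finally show ?thesis by (simp add: growth_const_def algebra_simps)
qed

lemma integrable_shifted: "integrable std_gaussian (\<lambda>u. f (x + \<mu> *\<^sub>R u))"
proof -
  interpret prob_space "std_gaussian :: (real^'n) measure" by (rule prob_space_std_gaussian)
  have "integrable std_gaussian (\<lambda>u. f (x + \<mu> *\<^sub>R u) - f x)"
    by (rule integrable_std_gaussian_poly[where C = "\<bar>\<mu>\<bar> * growth_const" and k = 2])
       (use difference_growth in \<open>auto simp: mult.assoc\<close>)
  then have "integrable std_gaussian (\<lambda>u. f (x + \<mu> *\<^sub>R u) - f x + f x)"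
    by (rule Bochner_Integration.integrable_add) simp
  then show ?thesis by simp
qed

lemma integrable_shifted_gradient: "integrable std_gaussian (\<lambda>u. df (x + \<mu> *\<^sub>R u))"
  by (rule integrable_std_gaussian_poly[OF _ gradient_growth]) simp

lemma two_point_oracle_growth:
  assumes "\<mu> > 0"
  shows "norm (two_point_oracle \<mu> f x u) \<le> growth_const * (1 + norm u) ^ 3"
proof -
  have "norm (two_point_oracle \<mu> f x u) = \<bar>f (x + \<mu> *\<^sub>R u) - f x\<bar> / \<mu> * norm u"
    using assms by (simp add: two_point_oracle_def abs_mult)
  also have "\<dots> \<le> (growth_const * (1 + norm u)\<^sup>2) * (1 + norm u)"
    using difference_growth[of u] assms growth_const_nonneg
    by (intro mult_mono) (auto simp: pos_divide_le_eq mult.commute)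
  finally show ?thesis by (simp add: power3_eq_cube power2_eq_square mult_ac)
qed

lemma integrable_two_point_oracle:
  assumes "\<mu> > 0"
  shows "integrable std_gaussian (two_point_oracle \<mu> f x)"
    and "integrable std_gaussian (\<lambda>u. (norm (two_point_oracle \<mu> f x u - a))\<^sup>2)"
proof -
  have [measurable]: "two_point_oracle \<mu> f x \<in> borel_measurable borel"
    unfolding two_point_oracle_def[abs_def] by simp
  show "integrable std_gaussian (two_point_oracle \<mu> f x)"
    by (rule integrable_std_gaussian_poly[OF _ two_point_oracle_growth]) (use assms in simp_all)
  have "norm ((norm (two_point_oracle \<mu> f x u - a))\<^sup>2) \<le> (growth_const + norm a)\<^sup>2 * (1 + norm u) ^ 6" for u
  proof -
    have "norm (two_point_oracle \<mu> f x u - a) \<le> growth_const * (1 + norm u) ^ 3 + norm a * 1"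
      using norm_triangle_ineq4[of "two_point_oracle \<mu> f x u" a] two_point_oracle_growth[OF assms, of u]
      by simp
    also have "\<dots> \<le> growth_const * (1 + norm u) ^ 3 + norm a * (1 + norm u) ^ 3"
      by (intro add_left_mono mult_left_mono one_le_power) auto
    finally have "(norm (two_point_oracle \<mu> f x u - a))\<^sup>2 \<le> ((growth_const + norm a) * (1 + norm u) ^ 3)\<^sup>2"
      by (intro power_mono) (auto simp: algebra_simps)
    then show ?thesis by (simp add: power_mult_distrib flip: power_mult)
  qed
  then show "integrable std_gaussian (\<lambda>u. (norm (two_point_oracle \<mu> f x u - a))\<^sup>2)"
    by (rule integrable_std_gaussian_poly[rotated]) simp
qed

text \<open>As a function of \<open>u\<close>, the difference quotient \<open>(f (x + \<mu> u) - f x) / \<mu>\<close> has gradient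
  \<open>df (x + \<mu> u)\<close>, so this is Gaussian integration by parts in each direction \<open>e\<close>.\<close>

lemma two_point_oracle_mean:
  assumes "\<mu> > 0"
  shows "(\<integral>u. two_point_oracle \<mu> f x u \<partial>std_gaussian) = (\<integral>u. df (x + \<mu> *\<^sub>R u) \<partial>std_gaussian)"
proof (rule vector_eq_rdot[THEN iffD1], rule allI)
  fix e :: "real^'n"
  have shift: "GDERIV (\<lambda>u. 1 / \<mu> * (f (x + \<mu> *\<^sub>R u) - f x)) u :> df (x + \<mu> *\<^sub>R u)" for u
  proof -
    have "((\<lambda>u. x + \<mu> *\<^sub>R u) has_derivative (\<lambda>h. \<mu> *\<^sub>R h)) (at u)"
      by (auto intro!: derivative_eq_intros)
    from has_derivative_compose[OF this GDERIV_f[of "x + \<mu> *\<^sub>R u", unfolded gderiv_def]]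
    show ?thesis
      unfolding gderiv_def using assms by (auto intro!: derivative_eq_intros)
  qed
  have "(\<integral>u. two_point_oracle \<mu> f x u \<partial>std_gaussian) \<bullet> e
      = (\<integral>u. 1 / \<mu> * (f (x + \<mu> *\<^sub>R u) - f x) * (u \<bullet> e) \<partial>std_gaussian)"
    by (subst integral_inner_left[symmetric])
       (use assms in \<open>auto simp: integrable_two_point_oracle two_point_oracle_def\<close>)
  also have "\<dots> = (\<integral>u. df (x + \<mu> *\<^sub>R u) \<bullet> e \<partial>std_gaussian)"
  proof (rule std_gaussian_stein[OF shift])
    show "\<bar>1 / \<mu> * (f (x + \<mu> *\<^sub>R u) - f x)\<bar> \<le> growth_const * (1 + norm u)\<^sup>2" for u
      using difference_growth[of u] assms by (simp add: abs_mult pos_divide_le_eq mult.commute)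
  qed (use gradient_growth in auto)
  also have "\<dots> = (\<integral>u. df (x + \<mu> *\<^sub>R u) \<partial>std_gaussian) \<bullet> e"
    by (rule integral_inner_left) (rule integrable_shifted_gradient)
  finally show "(\<integral>u. two_point_oracle \<mu> f x u \<partial>std_gaussian) \<bullet> e
      = (\<integral>u. df (x + \<mu> *\<^sub>R u) \<partial>std_gaussian) \<bullet> e" .
qed

end

text \<open>The linearisation error of \<open>f\<close> is bounded by \<open>L |d|\<^sup>2\<close> uniformly in the base point, and so is its
  average. Hence the average is differentiable, with the averaged gradient.\<close>

lemma grad_gaussian_smoothing:
  "grad (gaussian_smoothing \<mu> f) x = (\<integral>u. df (x + \<mu> *\<^sub>R u) \<partial>std_gaussian)"
proof (rule grad_eqI)
  interpret prob_space "std_gaussian :: (real^'n) measure" by (rule prob_space_std_gaussian)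
  let ?G = "\<integral>u. df (x + \<mu> *\<^sub>R u) \<partial>std_gaussian"
  have bound: "\<bar>gaussian_smoothing \<mu> f (x + d) - gaussian_smoothing \<mu> f x - d \<bullet> ?G\<bar>
      \<le> L * (norm d)\<^sup>2" for d
  proof -
    have int: "integrable std_gaussian (\<lambda>u. f (x + d + \<mu> *\<^sub>R u))"
        "integrable std_gaussian (\<lambda>u. f (x + \<mu> *\<^sub>R u))"
        "integrable std_gaussian (\<lambda>u. d \<bullet> df (x + \<mu> *\<^sub>R u))"
      by (auto intro: integrable_shifted integrable_shifted_gradient)
    have "gaussian_smoothing \<mu> f (x + d) - gaussian_smoothing \<mu> f x - d \<bullet> ?G
        = (\<integral>u. f (x + d + \<mu> *\<^sub>R u) - f (x + \<mu> *\<^sub>R u) - d \<bullet> df (x + \<mu> *\<^sub>R u) \<partial>std_gaussian)"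
      using int by (simp add: gaussian_smoothing_def integrable_shifted_gradient)
    moreover have "norm (\<integral>u. f (x + d + \<mu> *\<^sub>R u) - f (x + \<mu> *\<^sub>R u) - d \<bullet> df (x + \<mu> *\<^sub>R u) \<partial>std_gaussian)
        \<le> (\<integral>u. L * (norm d)\<^sup>2 \<partial>(std_gaussian :: (real^'n) measure))"
    proof (rule Bochner_Integration.integral_norm_bound_integral)
      show "norm (f (x + d + \<mu> *\<^sub>R u) - f (x + \<mu> *\<^sub>R u) - d \<bullet> df (x + \<mu> *\<^sub>R u)) \<le> L * (norm d)\<^sup>2" for u
        using linearisation_error[of "x + \<mu> *\<^sub>R u" d] by (simp add: inner_commute algebra_simps)
    qed (use int in auto)
    ultimately show ?thesis using prob_space by simp
  qed
  show "GDERIV (gaussian_smoothing \<mu> f) x :> ?G"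
    unfolding gderiv_def has_derivative_at
  proof
    show "bounded_linear (\<lambda>h. h \<bullet> ?G)" by (rule bounded_linear_inner_left)
    show "(\<lambda>d. norm (gaussian_smoothing \<mu> f (x + d) - gaussian_smoothing \<mu> f x - d \<bullet> ?G) / norm d)
        \<midarrow>0\<rightarrow> 0"
    proof (rule tendsto_sandwich[where f = "\<lambda>_. 0" and h = "\<lambda>d. L * norm d"])
      show "((\<lambda>d::real^'n. L * norm d) \<longlongrightarrow> 0) (at 0)"
        by (auto intro!: tendsto_eq_intros)
      show "\<forall>\<^sub>F d in at 0. norm (gaussian_smoothing \<mu> f (x + d) - gaussian_smoothing \<mu> f x - d \<bullet> ?G) / norm d
          \<le> L * norm d"
        unfolding eventually_at_filter
        by (intro always_eventually allI impI)
           (use bound in \<open>auto simp: pos_divide_le_eq power2_eq_square mult.assoc\<close>)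
    qed auto
  qed
qed

lemma grad_gaussian_smoothing_lipschitz:
  "norm (grad (gaussian_smoothing \<mu> f) x - grad (gaussian_smoothing \<mu> f) y) \<le> L * norm (x - y)"
proof -
  interpret prob_space "std_gaussian :: (real^'n) measure" by (rule prob_space_std_gaussian)
  have "norm (\<integral>u. df (x + \<mu> *\<^sub>R u) - df (y + \<mu> *\<^sub>R u) \<partial>std_gaussian)
      \<le> (\<integral>u. L * norm (x - y) \<partial>(std_gaussian :: (real^'n) measure))"
  proof (rule Bochner_Integration.integral_norm_bound_integral)
    show "norm (df (x + \<mu> *\<^sub>R u) - df (y + \<mu> *\<^sub>R u)) \<le> L * norm (x - y)" for u
      using df_lipschitz[of "x + \<mu> *\<^sub>R u" "y + \<mu> *\<^sub>R u"] by simp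
  qed (auto intro: integrable_shifted_gradient)
  then show ?thesis
    using prob_space by (simp add: grad_gaussian_smoothing integrable_shifted_gradient)
qed

text \<open>The bias is at most \<open>\<mu> L\<close> times the mean of \<open>|u|\<close>, and \<open>|u| \<le> (1 + |u|\<^sup>2) / 2\<close>. The
  resulting factor \<open>1 + n\<close> is below \<open>(n + 3)^(3/2)\<close>, the customary dimension dependence.\<close>

lemma grad_gaussian_smoothing_bias:
  assumes "\<mu> > 0"
  shows "norm (df x - grad (gaussian_smoothing \<mu> f) x)
    \<le> \<mu> / 2 * L * (real CARD('n) + 3) powr (3 / 2)"
proof -
  interpret prob_space "std_gaussian :: (real^'n) measure" by (rule prob_space_std_gaussian)
  have int: "integrable std_gaussian (\<lambda>u::real^'n. \<mu> * L / 2 * (1 + (norm u)\<^sup>2))"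
    by (intro integrable_mult_right Bochner_Integration.integrable_add std_gaussian_second_moment) simp
  have "df x - grad (gaussian_smoothing \<mu> f) x = (\<integral>u. df x - df (x + \<mu> *\<^sub>R u) \<partial>std_gaussian)"
    using prob_space by (simp add: grad_gaussian_smoothing integrable_shifted_gradient)
  also have "norm \<dots> \<le> (\<integral>u. \<mu> * L / 2 * (1 + (norm u)\<^sup>2) \<partial>(std_gaussian :: (real^'n) measure))"
  proof (rule Bochner_Integration.integral_norm_bound_integral)
    fix u :: "real^'n"
    have "norm (df x - df (x + \<mu> *\<^sub>R u)) \<le> \<mu> * L * norm u"
      using df_lipschitz[of x "x + \<mu> *\<^sub>R u"] assms by (simp add: mult_ac)
    also have "\<dots> \<le> \<mu> * L * ((1 + (norm u)\<^sup>2) / 2)"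
      using assms L_nonneg zero_le_power2[of "norm u - 1"]
      by (intro mult_left_mono) (auto simp: power2_diff)
    finally show "norm (df x - df (x + \<mu> *\<^sub>R u)) \<le> \<mu> * L / 2 * (1 + (norm u)\<^sup>2)" by simp
  qed (use int in \<open>auto intro: integrable_shifted_gradient\<close>)
  also have "\<dots> = \<mu> / 2 * L * (1 + real CARD('n))"
    using prob_space by (simp add: std_gaussian_second_moment)
  also have "\<dots> \<le> \<mu> / 2 * L * (real CARD('n) + 3) powr (3 / 2)"
  proof -
    have "1 + real CARD('n) \<le> (real CARD('n) + 3) powr 1" by simp
    also have "\<dots> \<le> (real CARD('n) + 3) powr (3 / 2)" by (intro powr_mono) auto
    finally show ?thesis using assms L_nonneg by (intro mult_left_mono) auto
  qed
  finally show ?thesis .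
qed

end

section \<open>Square-integrable random vectors\<close>

definition square_integrable :: "'w measure \<Rightarrow> ('w \<Rightarrow> 'a::euclidean_space) \<Rightarrow> bool" where
  "square_integrable M X \<longleftrightarrow> X \<in> borel_measurable M \<and> integrable M (\<lambda>\<omega>. (norm (X \<omega>))\<^sup>2)"

lemma square_integrable_measurable: "square_integrable M X \<Longrightarrow> X \<in> borel_measurable M"
  and square_integrable_norm: "square_integrable M X \<Longrightarrow> integrable M (\<lambda>\<omega>. (norm (X \<omega>))\<^sup>2)"
  by (auto simp: square_integrable_def)

lemma square_integrable_bound:
  assumes "X \<in> borel_measurable M" "integrable M g" "\<And>\<omega>. (norm (X \<omega>))\<^sup>2 \<le> g \<omega>"
  shows "square_integrable M X"
  unfolding square_integrable_def
proof
  show "integrable M (\<lambda>\<omega>. (norm (X \<omega>))\<^sup>2)"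
  proof (rule Bochner_Integration.integrable_bound[OF assms(2)])
    show "(\<lambda>\<omega>. (norm (X \<omega>))\<^sup>2) \<in> borel_measurable M"
      using assms(1) by simp
    have "norm ((norm (X \<omega>))\<^sup>2) \<le> norm (g \<omega>)" for \<omega>
      using assms(3)[of \<omega>] by simp
    then show "AE \<omega> in M. norm ((norm (X \<omega>))\<^sup>2) \<le> norm (g \<omega>)"
      by simp
  qed
qed fact

lemma norm_add_sq_le: "(norm (x + y))\<^sup>2 \<le> 2 * (norm x)\<^sup>2 + 2 * (norm (y::'a::real_normed_vector))\<^sup>2"
proof -
  have "(norm (x + y))\<^sup>2 \<le> (norm x + norm y)\<^sup>2"
    by (intro power_mono norm_triangle_ineq) simp
  also have "\<dots> \<le> 2 * (norm x)\<^sup>2 + 2 * (norm y)\<^sup>2"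
    using zero_le_power2[of "norm x - norm y"] by (simp add: power2_sum power2_diff)
  finally show ?thesis .
qed

lemma square_integrable_add:
  assumes "square_integrable M X" "square_integrable M Y"
  shows "square_integrable M (\<lambda>\<omega>. X \<omega> + Y \<omega>)"
proof (rule square_integrable_bound)
  show "integrable M (\<lambda>\<omega>. 2 * (norm (X \<omega>))\<^sup>2 + 2 * (norm (Y \<omega>))\<^sup>2)"
    using assms by (auto simp: square_integrable_def)
  show "(\<lambda>\<omega>. X \<omega> + Y \<omega>) \<in> borel_measurable M"
    using assms by (auto simp: square_integrable_def)
qed (rule norm_add_sq_le)

lemma square_integrable_scaleR:
  assumes "square_integrable M X"
  shows "square_integrable M (\<lambda>\<omega>. a *\<^sub>R X \<omega>)"
  using assms by (auto simp: square_integrable_def power_mult_distrib)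

lemma square_integrable_diff:
  assumes "square_integrable M X" "square_integrable M Y"
  shows "square_integrable M (\<lambda>\<omega>. X \<omega> - Y \<omega>)"
  using square_integrable_add[OF assms(1) square_integrable_scaleR[OF assms(2), of "- 1"]] by simp

lemma (in finite_measure) square_integrable_const: "square_integrable M (\<lambda>_. a)"
  by (simp add: square_integrable_def)

lemma (in finite_measure) square_integrable_sum:
  assumes "finite I" "\<And>i. i \<in> I \<Longrightarrow> square_integrable M (X i)"
  shows "square_integrable M (\<lambda>\<omega>. \<Sum>i\<in>I. X i \<omega>)"
  using assms
proof (induction I rule: finite_induct)
  case (insert j I)
  have "square_integrable M (\<lambda>\<omega>. X j \<omega> + (\<Sum>i\<in>I. X i \<omega>))"
    by (rule square_integrable_add) (simp_all add: insert)
  then show ?case by (simp add: insert.hyps)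
qed (simp add: square_integrable_const)

lemma (in finite_measure) square_integrable_lipschitz:
  fixes g :: "'b::euclidean_space \<Rightarrow> 'c::euclidean_space"
  assumes X: "square_integrable M X"
    and g: "\<And>x y. norm (g x - g y) \<le> K * norm (x - y)"
  shows "square_integrable M (\<lambda>\<omega>. g (X \<omega>))"
proof -
  have [measurable]: "X \<in> borel_measurable M" by (rule square_integrable_measurable[OF X])
  have "continuous_on UNIV g"
  proof (rule lipschitz_on_continuous_on)
    show "\<bar>K\<bar>-lipschitz_on UNIV g"
      unfolding lipschitz_on_def dist_norm
      using order_trans[OF g mult_right_mono[OF abs_ge_self norm_ge_zero]] by simp
  qed
  then have [measurable]: "g \<in> borel_measurable borel" by (rule borel_measurable_continuous_onI)
  have "square_integrable M (\<lambda>\<omega>. g (X \<omega>) - g 0)"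
  proof (rule square_integrable_bound)
    show "integrable M (\<lambda>\<omega>. K\<^sup>2 * (norm (X \<omega>))\<^sup>2)"
      using X by (auto simp: square_integrable_def)
    show "(norm (g (X \<omega>) - g 0))\<^sup>2 \<le> K\<^sup>2 * (norm (X \<omega>))\<^sup>2" for \<omega>
      using power_mono[OF g[of "X \<omega>" 0], of 2] by (simp add: power_mult_distrib)
  qed simp
  from square_integrable_add[OF this square_integrable_const[of "g 0"]] show ?thesis by simp
qed

lemma abs_inner_le_norm_sq: "\<bar>x \<bullet> y\<bar> \<le> (norm x)\<^sup>2 + (norm (y::'a::real_inner))\<^sup>2"
proof -
  have "\<bar>x \<bullet> y\<bar> \<le> norm x * norm y" by (rule Cauchy_Schwarz_ineq2)
  also have "\<dots> \<le> (norm x)\<^sup>2 + (norm y)\<^sup>2"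
    using sum_squares_bound[of "norm x" "norm y"] mult_nonneg_nonneg[of "norm x" "norm y"]
    by (simp add: mult.assoc del: mult_nonneg_nonneg zero_le_mult_iff)
  finally show ?thesis .
qed

lemma square_integrable_inner:
  assumes "square_integrable M X" "square_integrable M Y"
  shows "integrable M (\<lambda>\<omega>. X \<omega> \<bullet> Y \<omega>)"
proof (rule Bochner_Integration.integrable_bound)
  show "integrable M (\<lambda>\<omega>. (norm (X \<omega>))\<^sup>2 + (norm (Y \<omega>))\<^sup>2)"
    using assms by (auto simp: square_integrable_def)
  show "AE \<omega> in M. norm (X \<omega> \<bullet> Y \<omega>) \<le> norm ((norm (X \<omega>))\<^sup>2 + (norm (Y \<omega>))\<^sup>2)"
    by (intro AE_I2) (use abs_inner_le_norm_sq in auto)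
qed (use assms in \<open>auto simp: square_integrable_def\<close>)

lemma (in finite_measure) square_integrable_integrable:
  assumes "square_integrable M X"
  shows "integrable M X"
proof (rule Bochner_Integration.integrable_bound)
  show "integrable M (\<lambda>\<omega>. 1 + (norm (X \<omega>))\<^sup>2)"
    using assms by (auto simp: square_integrable_def)
  have "r \<le> 1 + r\<^sup>2" for r :: real
    using zero_le_power2[of "r - 1 / 2"] by (simp add: power2_diff power_divide)
  then show "AE \<omega> in M. norm (X \<omega>) \<le> norm (1 + (norm (X \<omega>))\<^sup>2)"
    by simp
qed (use assms in \<open>auto simp: square_integrable_def\<close>)

text \<open>The bias-variance decomposition: \<open>X - E X\<close> is orthogonal to constants.\<close>

lemma (in prob_space) mean_square_decomposition:
  assumes X: "square_integrable M X"
  shows "(\<integral>\<omega>. (norm (X \<omega> - b))\<^sup>2 \<partial>M)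
    = (\<integral>\<omega>. (norm (X \<omega> - (\<integral>\<omega>. X \<omega> \<partial>M)))\<^sup>2 \<partial>M) + (norm ((\<integral>\<omega>. X \<omega> \<partial>M) - b))\<^sup>2"
proof -
  define m where "m = (\<integral>\<omega>. X \<omega> \<partial>M)"
  have X1: "integrable M X" by (rule square_integrable_integrable[OF X])
  have Xm: "integrable M (\<lambda>\<omega>. (norm (X \<omega> - m))\<^sup>2)"
    by (intro square_integrable_norm square_integrable_diff X square_integrable_const)
  have "(norm (X \<omega> - b))\<^sup>2 = (norm (X \<omega> - m))\<^sup>2 + 2 * ((X \<omega> - m) \<bullet> (m - b)) + (norm (m - b))\<^sup>2" for \<omega>
    by (simp add: power2_norm_eq_inner inner_diff_left inner_diff_right inner_commute)
  moreover have "(\<integral>\<omega>. (X \<omega> - m) \<bullet> (m - b) \<partial>M) = (\<integral>\<omega>. X \<omega> - m \<partial>M) \<bullet> (m - b)"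
    using X1 by (intro integral_inner_left) simp
  moreover have "(\<integral>\<omega>. X \<omega> - m \<partial>M) = 0"
    using X1 prob_space by (simp add: m_def)
  ultimately have "(\<integral>\<omega>. (norm (X \<omega> - b))\<^sup>2 \<partial>M) = (\<integral>\<omega>. (norm (X \<omega> - m))\<^sup>2 \<partial>M) + (norm (m - b))\<^sup>2"
    using X1 Xm prob_space by (simp del: integral_inner_left)
  then show ?thesis by (simp add: m_def)
qed

text \<open>Jensen's inequality for the squared norm, read off from the bias-variance decomposition.\<close>

lemma (in prob_space) norm_expectation_sq_le:
  assumes "square_integrable M X"
  shows "(norm ((\<integral>\<omega>. X \<omega> \<partial>M) - b))\<^sup>2 \<le> (\<integral>\<omega>. (norm (X \<omega> - b))\<^sup>2 \<partial>M)"
  using mean_square_decomposition[OF assms, of b] by simp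

lemma (in prob_space) variance_le_mean_square:
  assumes "square_integrable M X"
  shows "(\<integral>\<omega>. (norm (X \<omega> - (\<integral>\<omega>. X \<omega> \<partial>M)))\<^sup>2 \<partial>M) \<le> (\<integral>\<omega>. (norm (X \<omega> - b))\<^sup>2 \<partial>M)"
  using mean_square_decomposition[OF assms, of b] by simp

text \<open>The Pythagorean theorem in the space of square-integrable random vectors.\<close>

lemma (in prob_space) mean_square_orthogonal_sum:
  assumes "finite I" and W: "square_integrable M W"
    and Y: "\<And>i. i \<in> I \<Longrightarrow> square_integrable M (Y i)"
    and WY: "\<And>i. i \<in> I \<Longrightarrow> (\<integral>\<omega>. W \<omega> \<bullet> Y i \<omega> \<partial>M) = 0"
    and YY: "\<And>i j. i \<in> I \<Longrightarrow> j \<in> I \<Longrightarrow> i \<noteq> j \<Longrightarrow> (\<integral>\<omega>. Y i \<omega> \<bullet> Y j \<omega> \<partial>M) = 0"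
  shows "(\<integral>\<omega>. (norm (W \<omega> + (\<Sum>i\<in>I. Y i \<omega>)))\<^sup>2 \<partial>M)
    = (\<integral>\<omega>. (norm (W \<omega>))\<^sup>2 \<partial>M) + (\<Sum>i\<in>I. \<integral>\<omega>. (norm (Y i \<omega>))\<^sup>2 \<partial>M)"
  using assms(1) Y WY YY
proof (induction I rule: finite_induct)
  case (insert j I)
  define S where "S \<omega> = W \<omega> + (\<Sum>i\<in>I. Y i \<omega>)" for \<omega>
  have S: "square_integrable M S"
    unfolding S_def using insert by (intro square_integrable_add square_integrable_sum W) auto
  have Yj: "square_integrable M (Y j)" using insert by simp
  have "(\<integral>\<omega>. S \<omega> \<bullet> Y j \<omega> \<partial>M) = (\<integral>\<omega>. W \<omega> \<bullet> Y j \<omega> + (\<Sum>i\<in>I. Y i \<omega> \<bullet> Y j \<omega>) \<partial>M)"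
    by (simp add: S_def inner_add_left inner_sum_left)
  also have "\<dots> = (\<integral>\<omega>. W \<omega> \<bullet> Y j \<omega> \<partial>M) + (\<Sum>i\<in>I. \<integral>\<omega>. Y i \<omega> \<bullet> Y j \<omega> \<partial>M)"
    using insert W by (simp add: square_integrable_inner)
  also have "\<dots> = 0"
    using insert by (auto intro!: sum.neutral)
  finally have SY: "(\<integral>\<omega>. S \<omega> \<bullet> Y j \<omega> \<partial>M) = 0" .
  have "W \<omega> + (\<Sum>i\<in>insert j I. Y i \<omega>) = S \<omega> + Y j \<omega>" for \<omega>
    using insert.hyps by (simp add: S_def add_ac)
  then have "(\<integral>\<omega>. (norm (W \<omega> + (\<Sum>i\<in>insert j I. Y i \<omega>)))\<^sup>2 \<partial>M)
      = (\<integral>\<omega>. (norm (S \<omega>))\<^sup>2 + 2 * (S \<omega> \<bullet> Y j \<omega>) + (norm (Y j \<omega>))\<^sup>2 \<partial>M)"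
    by (simp add: power2_norm_eq_inner inner_add_left inner_add_right inner_commute add_ac)
  also have "\<dots> = (\<integral>\<omega>. (norm (S \<omega>))\<^sup>2 \<partial>M) + (\<integral>\<omega>. (norm (Y j \<omega>))\<^sup>2 \<partial>M)"
    using SY by (simp add: square_integrable_norm[OF S] square_integrable_norm[OF Yj]
        square_integrable_inner[OF S Yj])
  also have "(\<integral>\<omega>. (norm (S \<omega>))\<^sup>2 \<partial>M)
      = (\<integral>\<omega>. (norm (W \<omega>))\<^sup>2 \<partial>M) + (\<Sum>i\<in>I. \<integral>\<omega>. (norm (Y i \<omega>))\<^sup>2 \<partial>M)"
    unfolding S_def using insert by auto
  finally show ?case using insert.hyps by (simp add: add_ac)
qed simp

section \<open>Noise driven by an independent variable\<close>

text \<open>The next two lemmas replace conditional expectations. If \<open>U\<close> is independent of \<open>X\<close>, the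
  conditional law of \<open>\<xi> X U\<close> given \<open>X = x\<close> is the law of \<open>\<xi> x U\<close>, so a bound that holds for every
  fixed \<open>x\<close> may be integrated over \<open>x\<close>. Independence is expressed by the joint distribution, which
  allows \<open>X\<close> and \<open>U\<close> to have values in different types.\<close>

lemma (in prob_space) conditional_mean_square_le:
  fixes \<xi> :: "'x \<Rightarrow> 'y \<Rightarrow> 'b::euclidean_space"
  assumes X[measurable]: "X \<in> measurable M N" and U[measurable]: "U \<in> measurable M S"
    and joint: "distr M (N \<Otimes>\<^sub>M S) (\<lambda>\<omega>. (X \<omega>, U \<omega>)) = distr M N X \<Otimes>\<^sub>M distr M S U"
    and meas: "(\<lambda>p. \<xi> (fst p) (snd p)) \<in> borel_measurable (N \<Otimes>\<^sub>M S)"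
    and int: "\<And>x. x \<in> space N \<Longrightarrow> integrable (distr M S U) (\<lambda>v. (norm (\<xi> x v))\<^sup>2)"
    and le: "\<And>x. x \<in> space N \<Longrightarrow> (\<integral>v. (norm (\<xi> x v))\<^sup>2 \<partial>distr M S U) \<le> s"
    and s: "0 \<le> s"
  shows "square_integrable M (\<lambda>\<omega>. \<xi> (X \<omega>) (U \<omega>))"
    and "(\<integral>\<omega>. (norm (\<xi> (X \<omega>) (U \<omega>)))\<^sup>2 \<partial>M) \<le> s"
proof -
  interpret X: prob_space "distr M N X" by (rule prob_space_distr) simp
  interpret U: prob_space "distr M S U" by (rule prob_space_distr) simp
  have [measurable]: "(\<lambda>\<omega>. \<xi> (X \<omega>) (U \<omega>)) \<in> borel_measurable M"
    using measurable_compose[OF measurable_Pair[of X M N U S] meas] by simp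
  have "(\<integral>\<^sup>+\<omega>. ennreal ((norm (\<xi> (X \<omega>) (U \<omega>)))\<^sup>2) \<partial>M)
      = (\<integral>\<^sup>+p. ennreal ((norm (\<xi> (fst p) (snd p)))\<^sup>2) \<partial>distr M (N \<Otimes>\<^sub>M S) (\<lambda>\<omega>. (X \<omega>, U \<omega>)))"
    using meas by (subst nn_integral_distr) auto
  also note joint
  also have "(\<integral>\<^sup>+p. ennreal ((norm (\<xi> (fst p) (snd p)))\<^sup>2) \<partial>(distr M N X \<Otimes>\<^sub>M distr M S U))
      = (\<integral>\<^sup>+x. \<integral>\<^sup>+v. ennreal ((norm (\<xi> x v))\<^sup>2) \<partial>distr M S U \<partial>distr M N X)"
    using meas by (subst U.nn_integral_fst[symmetric]) simp_all
  also have "\<dots> \<le> (\<integral>\<^sup>+x. ennreal s \<partial>distr M N X)"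
  proof (rule nn_integral_mono)
    fix x assume "x \<in> space (distr M N X)"
    then have x: "x \<in> space N" by simp
    show "(\<integral>\<^sup>+v. ennreal ((norm (\<xi> x v))\<^sup>2) \<partial>distr M S U) \<le> ennreal s"
      using int[OF x] le[OF x] by (subst nn_integral_eq_integral) (auto intro: ennreal_leI)
  qed
  also have "\<dots> = ennreal s"
    using X.emeasure_space_1 by simp
  finally have bound: "(\<integral>\<^sup>+\<omega>. ennreal ((norm (\<xi> (X \<omega>) (U \<omega>)))\<^sup>2) \<partial>M) \<le> ennreal s" .
  then have int: "integrable M (\<lambda>\<omega>. (norm (\<xi> (X \<omega>) (U \<omega>)))\<^sup>2)"
    by (intro integrableI_bounded) (auto intro: le_less_trans)
  then show "square_integrable M (\<lambda>\<omega>. \<xi> (X \<omega>) (U \<omega>))"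
    by (simp add: square_integrable_def)
  show "(\<integral>\<omega>. (norm (\<xi> (X \<omega>) (U \<omega>)))\<^sup>2 \<partial>M) \<le> s"
    using bound s by (subst (asm) nn_integral_eq_integral[OF int]) auto
qed

text \<open>Given \<open>X\<close>, the factor \<open>\<Phi> X\<close> is constant and \<open>\<xi> X U\<close> has mean zero.\<close>

lemma (in prob_space) conditionally_centred_orthogonal:
  fixes \<xi> :: "'x \<Rightarrow> 'y \<Rightarrow> 'b::euclidean_space"
  assumes X[measurable]: "X \<in> measurable M N" and U[measurable]: "U \<in> measurable M S"
    and joint: "distr M (N \<Otimes>\<^sub>M S) (\<lambda>\<omega>. (X \<omega>, U \<omega>)) = distr M N X \<Otimes>\<^sub>M distr M S U"
    and meas: "(\<lambda>p. \<xi> (fst p) (snd p)) \<in> borel_measurable (N \<Otimes>\<^sub>M S)"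
    and sq: "square_integrable M (\<lambda>\<omega>. \<xi> (X \<omega>) (U \<omega>))"
    and int: "\<And>x. x \<in> space N \<Longrightarrow> integrable (distr M S U) (\<xi> x)"
    and centred: "\<And>x. x \<in> space N \<Longrightarrow> (\<integral>v. \<xi> x v \<partial>distr M S U) = 0"
    and \<Phi>[measurable]: "\<Phi> \<in> borel_measurable N"
    and sq\<Phi>: "square_integrable M (\<lambda>\<omega>. \<Phi> (X \<omega>))"
  shows "(\<integral>\<omega>. \<Phi> (X \<omega>) \<bullet> \<xi> (X \<omega>) (U \<omega>) \<partial>M) = 0"
proof -
  interpret X: prob_space "distr M N X" by (rule prob_space_distr) simp
  interpret U: prob_space "distr M S U" by (rule prob_space_distr) simp
  interpret pair_sigma_finite "distr M N X" "distr M S U" ..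
  have meas': "(\<lambda>p. \<Phi> (fst p) \<bullet> \<xi> (fst p) (snd p)) \<in> borel_measurable (N \<Otimes>\<^sub>M S)"
    using meas by simp
  have int': "integrable (distr M N X \<Otimes>\<^sub>M distr M S U) (\<lambda>p. \<Phi> (fst p) \<bullet> \<xi> (fst p) (snd p))"
    unfolding joint[symmetric] using meas' square_integrable_inner[OF sq\<Phi> sq]
    by (subst integrable_distr_eq) auto
  have "(\<integral>\<omega>. \<Phi> (X \<omega>) \<bullet> \<xi> (X \<omega>) (U \<omega>) \<partial>M)
      = (\<integral>p. \<Phi> (fst p) \<bullet> \<xi> (fst p) (snd p) \<partial>(distr M N X \<Otimes>\<^sub>M distr M S U))"
    unfolding joint[symmetric] using meas' by (subst integral_distr) auto
  also have "\<dots> = (\<integral>x. \<integral>v. \<Phi> x \<bullet> \<xi> x v \<partial>distr M S U \<partial>distr M N X)"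
    using integral_fst'[OF int'] by simp
  also have "\<dots> = (\<integral>x. 0 \<partial>distr M N X)"
    using int centred by (intro Bochner_Integration.integral_cong) auto
  finally show ?thesis by simp
qed

text \<open>Disjoint subfamilies of an independent family are independent, and the member at \<open>a\<close> is the image of the subfamily indexed by \<open>{a}\<close>
  under evaluation at \<open>a\<close>.\<close>

lemma (in prob_space) joint_distr_restrict_single:
  assumes u: "indep_vars (\<lambda>_. N) u I" and "a \<in> I" "K \<subseteq> I" "a \<notin> K"
  shows "(\<lambda>\<omega>. restrict (\<lambda>p. u p \<omega>) K) \<in> measurable M (PiM K (\<lambda>_. N))"
    and "u a \<in> measurable M N"
    and "distr M (PiM K (\<lambda>_. N) \<Otimes>\<^sub>M N) (\<lambda>\<omega>. (restrict (\<lambda>p. u p \<omega>) K, u a \<omega>))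
      = distr M (PiM K (\<lambda>_. N)) (\<lambda>\<omega>. restrict (\<lambda>p. u p \<omega>) K) \<Otimes>\<^sub>M distr M N (u a)"
proof -
  let ?P = "PiM K (\<lambda>_. N)" and ?Q = "PiM {a} (\<lambda>_. N)"
  let ?R = "\<lambda>\<omega>. restrict (\<lambda>p. u p \<omega>) K" and ?T = "\<lambda>\<omega>. restrict (\<lambda>p. u p \<omega>) {a}"
  have "indep_var ?P ?R ?Q ?T"
    using assms by (intro indep_var_restrict) auto
  then have [measurable]: "?R \<in> measurable M ?P" "?T \<in> measurable M ?Q"
    and joint: "distr M ?P ?R \<Otimes>\<^sub>M distr M ?Q ?T = distr M (?P \<Otimes>\<^sub>M ?Q) (\<lambda>\<omega>. (?R \<omega>, ?T \<omega>))"
    by (auto simp: indep_var_distribution_eq)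
  have eval [measurable]: "(\<lambda>w. w a) \<in> measurable ?Q N"
    by (intro measurable_component_singleton) simp
  show "?R \<in> measurable M ?P" by simp
  show ua [measurable]: "u a \<in> measurable M N"
    using u \<open>a \<in> I\<close> by (auto simp: indep_vars_def)
  have eq: "distr M N (u a) = distr (distr M ?Q ?T) N (\<lambda>w. w a)"
    by (subst distr_distr) (auto simp: comp_def)
  interpret T: prob_space "distr (distr M ?Q ?T) N (\<lambda>w. w a)"
    unfolding eq[symmetric] by (rule prob_space_distr) simp
  have "distr M ?P ?R \<Otimes>\<^sub>M distr M N (u a)
      = distr (distr M ?P ?R) ?P (\<lambda>w. w) \<Otimes>\<^sub>M distr (distr M ?Q ?T) N (\<lambda>w. w a)"
    unfolding eq by (simp add: distr_id2)
  also have "\<dots> = distr (distr M ?P ?R \<Otimes>\<^sub>M distr M ?Q ?T) (?P \<Otimes>\<^sub>M N) (\<lambda>(w, w'). (w, w' a))"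
    by (rule pair_measure_distr) (auto intro: T.sigma_finite_measure_axioms)
  also have "\<dots> = distr M (?P \<Otimes>\<^sub>M N) (\<lambda>\<omega>. (?R \<omega>, u a \<omega>))"
    unfolding joint by (subst distr_distr) (auto simp: comp_def)
  finally show "distr M (?P \<Otimes>\<^sub>M N) (\<lambda>\<omega>. (?R \<omega>, u a \<omega>)) = distr M ?P ?R \<Otimes>\<^sub>M distr M N (u a)"
    by simp
qed

section \<open>The zeroth-order iteration\<close>

lemma borel_measurable_two_point_oracle [measurable (raw)]:
  assumes [measurable]: "f \<in> borel_measurable borel" "X \<in> borel_measurable N" "V \<in> borel_measurable N"
  shows "(\<lambda>w. two_point_oracle \<mu> f (X w) (V w)) \<in> borel_measurable N"
  unfolding two_point_oracle_def by measurable

text \<open>The iterate is viewed as a function of the directions with index in \<open>K\<close>; it is determined by them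
  as soon as \<open>K\<close> contains the indices of the first \<open>k\<close> iterations.\<close>

lemma borel_measurable_zo_iterate:
  assumes [measurable]: "f \<in> borel_measurable borel"
    and "{..<k} \<times> {..<t} \<subseteq> K"
  shows "(\<lambda>w. zo_iterate \<mu> t c h f z0 (\<lambda>j i. w (j, i)) k) \<in> borel_measurable (PiM K (\<lambda>_. borel))"
  using assms(2)
proof (induction k)
  case (Suc k)
  have [measurable]: "(\<lambda>w. zo_iterate \<mu> t c h f z0 (\<lambda>j i. w (j, i)) k) \<in> borel_measurable (PiM K (\<lambda>_. borel))"
    using Suc by (auto simp: lessThan_Suc)
  have [measurable]: "(\<lambda>w. w (k, i)) \<in> borel_measurable (PiM K (\<lambda>_. borel))" if "i < t" for i
    using Suc.prems that by (intro measurable_component_singleton) auto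
  show ?case
    unfolding zo_iterate.simps averaged_oracle_def by measurable
qed simp

lemma zo_iterate_cong:
  assumes "\<And>j i. j < k \<Longrightarrow> i < t \<Longrightarrow> v j i = v' j i"
  shows "zo_iterate \<mu> t c h f z0 v k = zo_iterate \<mu> t c h f z0 v' k"
  using assms by (induction k) (simp_all add: averaged_oracle_def)

locale zo_gradient_descent = prob_space M + lipschitz_gradient f df L
  for M :: "'w measure" and f :: "real^'n \<Rightarrow> real" and df L +
  fixes \<mu> c h \<sigma> :: real and t :: nat and u :: "nat \<Rightarrow> nat \<Rightarrow> 'w \<Rightarrow> real^'n" and z0 :: "real^'n"
  assumes mu_pos: "\<mu> > 0" and c_nonneg: "c \<ge> 0" and h_pos: "h > 0" and t_pos: "t \<ge> 1"
    and oracle_variance: "(\<integral>v. (norm (two_point_oracle \<mu> f x v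
                      - grad (gaussian_smoothing \<mu> f) x))\<^sup>2 \<partial>std_gaussian) \<le> \<sigma>\<^sup>2"
    and directions_gaussian: "i < t \<Longrightarrow> distr M borel (u k i) = std_gaussian"
    and directions_indep: "indep_vars (\<lambda>_. borel) (\<lambda>(k, i). u k i) (UNIV \<times> {..<t})"
begin

definition smooth_grad :: "real^'n \<Rightarrow> real^'n" where
  "smooth_grad = grad (gaussian_smoothing \<mu> f)"

definition iterate :: "nat \<Rightarrow> 'w \<Rightarrow> real^'n" where
  "iterate k \<omega> = zo_iterate \<mu> t c h f z0 (\<lambda>k i. u k i \<omega>) k"

definition noise :: "nat \<Rightarrow> nat \<Rightarrow> 'w \<Rightarrow> real^'n" where
  "noise k i \<omega> = two_point_oracle \<mu> f (iterate k \<omega>) (u k i \<omega>) - smooth_grad (iterate k \<omega>)"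

text \<open>The iteration without noise: the map called \<open>B\<close> at the top.\<close>

definition mean_step :: "real^'n \<Rightarrow> real^'n" where
  "mean_step z = c *\<^sub>R z - h *\<^sub>R smooth_grad z"

lemma smooth_grad_lipschitz: "norm (smooth_grad x - smooth_grad y) \<le> L * norm (x - y)"
  unfolding smooth_grad_def by (rule grad_gaussian_smoothing_lipschitz)

lemma mean_step_lipschitz: "norm (mean_step x - mean_step y) \<le> (c + h * L) * norm (x - y)"
proof -
  have "mean_step x - mean_step y = c *\<^sub>R (x - y) - h *\<^sub>R (smooth_grad x - smooth_grad y)"
    by (simp add: mean_step_def algebra_simps)
  also have "norm \<dots> \<le> c * norm (x - y) + h * norm (smooth_grad x - smooth_grad y)"
    using norm_triangle_ineq4[of "c *\<^sub>R (x - y)" "h *\<^sub>R (smooth_grad x - smooth_grad y)"] c_nonneg h_pos by simp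
  also have "\<dots> \<le> c * norm (x - y) + h * (L * norm (x - y))"
    using smooth_grad_lipschitz[of x y] h_pos by simp
  finally show ?thesis by (simp add: algebra_simps)
qed

lemma iterate_0 [simp]: "iterate 0 \<omega> = z0"
  by (simp add: iterate_def)

lemma iterate_Suc: "iterate (Suc k) \<omega> = mean_step (iterate k \<omega>) + (\<Sum>i<t. (- h / real t) *\<^sub>R noise k i \<omega>)"
proof -
  have "(\<Sum>i<t. (- h / real t) *\<^sub>R noise k i \<omega>)
      = (- h / real t) *\<^sub>R (\<Sum>i<t. two_point_oracle \<mu> f (iterate k \<omega>) (u k i \<omega>)) + h *\<^sub>R smooth_grad (iterate k \<omega>)"
    using t_pos
    by (simp add: noise_def scaleR_sum_right[symmetric] sum_subtractf scaleR_diff_right sum_constant_scaleR del: sum_constant)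
  then show ?thesis
    by (simp add: iterate_def mean_step_def averaged_oracle_def)
qed

text \<open>The past, as one random variable. The index set is a parameter, because orthogonality of two noise
  terms of the same iteration needs the past together with the direction of one of them.\<close>

definition directions :: "(nat \<times> nat) set \<Rightarrow> 'w \<Rightarrow> nat \<times> nat \<Rightarrow> real^'n" where
  "directions K \<omega> = (\<lambda>(k, i)\<in>K. u k i \<omega>)"

definition iterate_of :: "nat \<Rightarrow> (nat \<times> nat \<Rightarrow> real^'n) \<Rightarrow> real^'n" where
  "iterate_of k w = zo_iterate \<mu> t c h f z0 (\<lambda>j i. w (j, i)) k"

lemma iterate_of_directions:
  assumes "{..<k} \<times> {..<t} \<subseteq> K"
  shows "iterate_of k (directions K \<omega>) = iterate k \<omega>"
  unfolding iterate_of_def iterate_def using assms by (intro zo_iterate_cong) (auto simp: directions_def)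

lemma iterate_of_measurable:
  assumes "{..<k} \<times> {..<t} \<subseteq> K"
  shows "iterate_of k \<in> borel_measurable (PiM K (\<lambda>_. borel))"
  unfolding iterate_of_def[abs_def] by (rule borel_measurable_zo_iterate) (use assms in simp_all)

lemma smooth_grad_measurable [measurable]: "smooth_grad \<in> borel_measurable borel"
proof (rule borel_measurable_continuous_onI, rule lipschitz_on_continuous_on)
  show "L-lipschitz_on UNIV smooth_grad"
    using smooth_grad_lipschitz L_nonneg by (auto simp: lipschitz_on_def dist_norm)
qed

lemma directions_fresh:
  assumes "K \<subseteq> UNIV \<times> {..<t}" "(k, i) \<notin> K" "i < t"
  shows "directions K \<in> measurable M (PiM K (\<lambda>_. borel))"
    and "u k i \<in> borel_measurable M"
    and "distr M (PiM K (\<lambda>_. borel) \<Otimes>\<^sub>M borel) (\<lambda>\<omega>. (directions K \<omega>, u k i \<omega>))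
      = distr M (PiM K (\<lambda>_. borel)) (directions K) \<Otimes>\<^sub>M distr M borel (u k i)"
  using joint_distr_restrict_single[OF directions_indep, of "(k, i)" K] assms
  by (auto simp: directions_def[abs_def] case_prod_beta')

lemma noise_kernel_measurable:
  assumes "{..<k} \<times> {..<t} \<subseteq> K"
  shows "(\<lambda>p. two_point_oracle \<mu> f (iterate_of k (fst p)) (snd p) - smooth_grad (iterate_of k (fst p)))
    \<in> borel_measurable (PiM K (\<lambda>_. borel) \<Otimes>\<^sub>M borel)"
proof -
  note [measurable] = iterate_of_measurable[OF assms]
  show ?thesis by measurable
qed

lemma noise_second_moment:
  assumes "i < t"
  shows "square_integrable M (noise k i)" and "(\<integral>\<omega>. (norm (noise k i \<omega>))\<^sup>2 \<partial>M) \<le> \<sigma>\<^sup>2"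
proof -
  let ?K = "{..<k} \<times> {..<t}"
  let ?\<xi> = "\<lambda>w v. two_point_oracle \<mu> f (iterate_of k w) v - smooth_grad (iterate_of k w)"
  have eq: "noise k i = (\<lambda>\<omega>. ?\<xi> (directions ?K \<omega>) (u k i \<omega>))"
    by (simp add: fun_eq_iff noise_def iterate_of_directions)
  have K: "?K \<subseteq> UNIV \<times> {..<t}" "(k, i) \<notin> ?K" by auto
  note facts = directions_fresh[OF K assms] noise_kernel_measurable[OF order_refl]
  have "integrable (distr M borel (u k i)) (\<lambda>v. (norm (?\<xi> w v))\<^sup>2)"
    and "(\<integral>v. (norm (?\<xi> w v))\<^sup>2 \<partial>distr M borel (u k i)) \<le> \<sigma>\<^sup>2" for w
    using assms oracle_variance[of "iterate_of k w"] mu_pos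
    by (simp_all add: directions_gaussian integrable_two_point_oracle smooth_grad_def)
  from conditional_mean_square_le[OF facts this]
  show "square_integrable M (noise k i)" "(\<integral>\<omega>. (norm (noise k i \<omega>))\<^sup>2 \<partial>M) \<le> \<sigma>\<^sup>2"
    unfolding eq by simp_all
qed

text \<open>Averaging over the direction \<open>(k, i)\<close>, with all directions in \<open>K\<close> held fixed, annihilates the
  noise and leaves \<open>W\<close> unchanged, because the oracle is unbiased for \<open>smooth_grad\<close>.\<close>

lemma noise_orthogonal:
  assumes "i < t" and K: "{..<k} \<times> {..<t} \<subseteq> K" "K \<subseteq> UNIV \<times> {..<t}" "(k, i) \<notin> K"
    and \<Phi>: "\<Phi> \<in> borel_measurable (PiM K (\<lambda>_. borel))"
    and W: "\<And>\<omega>. W \<omega> = \<Phi> (directions K \<omega>)" "square_integrable M W"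
  shows "(\<integral>\<omega>. W \<omega> \<bullet> noise k i \<omega> \<partial>M) = 0"
proof -
  interpret \<gamma>: prob_space "std_gaussian :: (real^'n) measure" by (rule prob_space_std_gaussian)
  let ?\<xi> = "\<lambda>w v. two_point_oracle \<mu> f (iterate_of k w) v - smooth_grad (iterate_of k w)"
  have eq: "noise k i = (\<lambda>\<omega>. ?\<xi> (directions K \<omega>) (u k i \<omega>))"
    by (simp add: fun_eq_iff noise_def iterate_of_directions K)
  have W': "W = (\<lambda>\<omega>. \<Phi> (directions K \<omega>))" using W by auto
  show ?thesis
    unfolding eq W'
  proof (rule conditionally_centred_orthogonal[OF directions_fresh noise_kernel_measurable])
    show "square_integrable M (\<lambda>\<omega>. ?\<xi> (directions K \<omega>) (u k i \<omega>))"
      using noise_second_moment(1)[OF assms(1), of k] by (simp only: eq)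
    show "square_integrable M (\<lambda>\<omega>. \<Phi> (directions K \<omega>))"
      using W(2) by (simp only: W')
    fix w
    show "integrable (distr M borel (u k i)) (?\<xi> w)"
      using assms(1) mu_pos by (simp add: directions_gaussian integrable_two_point_oracle)
    show "(\<integral>v. ?\<xi> w v \<partial>distr M borel (u k i)) = 0"
      using assms(1) mu_pos \<gamma>.prob_space
      by (simp add: directions_gaussian integrable_two_point_oracle two_point_oracle_mean
          smooth_grad_def grad_gaussian_smoothing)
  qed (use assms in auto)
qed

lemma iterate_square_integrable: "square_integrable M (iterate k)"
proof (induction k)
  case 0
  then show ?case using square_integrable_const[of z0] by (simp add: iterate_def[abs_def])
next
  case (Suc k)
  show ?case
    unfolding iterate_Suc[abs_def]
    by (intro square_integrable_add square_integrable_sum square_integrable_scaleR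
        square_integrable_lipschitz[OF Suc mean_step_lipschitz] noise_second_moment) auto
qed

text \<open>Orthogonality to constants, applied to the mean itself.\<close>

lemma noise_mean:
  assumes "i < t"
  shows "(\<integral>\<omega>. noise k i \<omega> \<partial>M) = 0"
proof -
  let ?m = "\<integral>\<omega>. noise k i \<omega> \<partial>M"
  have "(\<integral>\<omega>. ?m \<bullet> noise k i \<omega> \<partial>M) = 0"
    by (rule noise_orthogonal[where K = "{..<k} \<times> {..<t}" and \<Phi> = "\<lambda>_. ?m"])
       (use assms in \<open>auto intro: square_integrable_const\<close>)
  also have "(\<integral>\<omega>. ?m \<bullet> noise k i \<omega> \<partial>M) = ?m \<bullet> ?m"
    by (intro integral_inner_right square_integrable_integrable noise_second_moment assms)
  finally show ?thesis by simp
qed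

lemma mean_recursion:
  "(\<integral>\<omega>. iterate (Suc k) \<omega> \<partial>M) = c *\<^sub>R (\<integral>\<omega>. iterate k \<omega> \<partial>M) - h *\<^sub>R (\<integral>\<omega>. smooth_grad (iterate k \<omega>) \<partial>M)"
proof -
  have iter: "integrable M (iterate k)"
    by (intro square_integrable_integrable iterate_square_integrable)
  have smooth: "integrable M (\<lambda>\<omega>. smooth_grad (iterate k \<omega>))"
    by (intro square_integrable_integrable square_integrable_lipschitz[OF iterate_square_integrable smooth_grad_lipschitz])
  have N: "integrable M (noise k i)" if "i < t" for i
    using that by (intro square_integrable_integrable noise_second_moment)
  have S: "integrable M (\<lambda>\<omega>. mean_step (iterate k \<omega>))"
    unfolding mean_step_def using iter smooth by simp
  have "(\<integral>\<omega>. iterate (Suc k) \<omega> \<partial>M)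
      = (\<integral>\<omega>. mean_step (iterate k \<omega>) \<partial>M) + (\<integral>\<omega>. (\<Sum>i<t. (- h / real t) *\<^sub>R noise k i \<omega>) \<partial>M)"
    unfolding iterate_Suc
    by (intro Bochner_Integration.integral_add S Bochner_Integration.integrable_sum integrable_scaleR_right N) simp
  also have "(\<integral>\<omega>. (\<Sum>i<t. (- h / real t) *\<^sub>R noise k i \<omega>) \<partial>M)
      = (\<Sum>i<t. \<integral>\<omega>. (- h / real t) *\<^sub>R noise k i \<omega> \<partial>M)"
    by (intro Bochner_Integration.integral_sum integrable_scaleR_right N) simp
  also have "\<dots> = 0"
    by (simp add: noise_mean)
  finally have "(\<integral>\<omega>. iterate (Suc k) \<omega> \<partial>M) = (\<integral>\<omega>. mean_step (iterate k \<omega>) \<partial>M)"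
    by simp
  then show ?thesis
    using iter smooth by (simp add: mean_step_def)
qed

definition dispersion :: "nat \<Rightarrow> real" where
  "dispersion k = (\<integral>\<omega>. (norm (iterate k \<omega> - (\<integral>\<omega>. iterate k \<omega> \<partial>M)))\<^sup>2 \<partial>M)"

text \<open>The mean minimises the mean square distance, so \<open>iterate (Suc k)\<close> may be compared with the
  noise-free step from the mean of \<open>iterate k\<close>. This avoids having to know the mean of the new
  iterate, and makes the Lipschitz bound for \<open>mean_step\<close> applicable pointwise.\<close>

lemma dispersion_Suc: "dispersion (Suc k) \<le> (c + h * L)\<^sup>2 * dispersion k + h\<^sup>2 * \<sigma>\<^sup>2 / real t"
proof -
  define m where "m = (\<integral>\<omega>. iterate k \<omega> \<partial>M)"
  define W where "W \<omega> = mean_step (iterate k \<omega>) - mean_step m" for \<omega>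
  define Y where "Y i \<omega> = (- h / real t) *\<^sub>R noise k i \<omega>" for i \<omega>
  have W: "square_integrable M W"
    unfolding W_def[abs_def]
    by (intro square_integrable_diff square_integrable_const
        square_integrable_lipschitz[OF iterate_square_integrable mean_step_lipschitz])
  have Y: "square_integrable M (Y i)" if "i < t" for i
    unfolding Y_def[abs_def] using that by (intro square_integrable_scaleR noise_second_moment)
  have [measurable]: "mean_step \<in> borel_measurable borel"
    unfolding mean_step_def[abs_def] by measurable
  have WN: "(\<integral>\<omega>. W \<omega> \<bullet> noise k i \<omega> \<partial>M) = 0" if "i < t" for i
  proof (rule noise_orthogonal[where K = "{..<k} \<times> {..<t}" and \<Phi> = "\<lambda>w. mean_step (iterate_of k w) - mean_step m"])
    note [measurable] = iterate_of_measurable[OF order_refl, of k]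
    show "(\<lambda>w. mean_step (iterate_of k w) - mean_step m) \<in> borel_measurable (PiM ({..<k} \<times> {..<t}) (\<lambda>_. borel))"
      by measurable
    show "W \<omega> = mean_step (iterate_of k (directions ({..<k} \<times> {..<t}) \<omega>)) - mean_step m" for \<omega>
      by (simp add: W_def iterate_of_directions)
  qed (use that W in auto)
  \<comment> \<open>\<open>noise k j\<close> is a function of the past and of the direction \<open>(k, j)\<close>, but not of \<open>(k, i)\<close>.\<close>
  have NN: "(\<integral>\<omega>. noise k j \<omega> \<bullet> noise k i \<omega> \<partial>M) = 0" if "i < t" "j < t" "j \<noteq> i" for i j
  proof (rule noise_orthogonal[where K = "insert (k, j) ({..<k} \<times> {..<t})"
        and \<Phi> = "\<lambda>w. two_point_oracle \<mu> f (iterate_of k w) (w (k, j)) - smooth_grad (iterate_of k w)"])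
    let ?K = "insert (k, j) ({..<k} \<times> {..<t})"
    have sub: "{..<k} \<times> {..<t} \<subseteq> ?K" by auto
    note [measurable] = iterate_of_measurable[OF sub]
    have [measurable]: "(\<lambda>w. w (k, j)) \<in> borel_measurable (PiM ?K (\<lambda>_. borel))"
      by (intro measurable_component_singleton) simp
    show "(\<lambda>w. two_point_oracle \<mu> f (iterate_of k w) (w (k, j)) - smooth_grad (iterate_of k w))
        \<in> borel_measurable (PiM ?K (\<lambda>_. borel))"
      by measurable
    show "noise k j \<omega> = two_point_oracle \<mu> f (iterate_of k (directions ?K \<omega>)) (directions ?K \<omega> (k, j))
        - smooth_grad (iterate_of k (directions ?K \<omega>))" for \<omega>
      using iterate_of_directions[OF sub] by (simp add: noise_def) (simp add: directions_def)
  qed (use that in \<open>auto intro: noise_second_moment\<close>)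
  have WY: "(\<integral>\<omega>. W \<omega> \<bullet> Y i \<omega> \<partial>M) = 0" if "i < t" for i
    by (simp add: Y_def WN[OF that])
  have YY: "(\<integral>\<omega>. Y j \<omega> \<bullet> Y i \<omega> \<partial>M) = 0" if "i < t" "j < t" "j \<noteq> i" for i j
    by (simp add: Y_def NN[OF that])
  have "dispersion (Suc k) \<le> (\<integral>\<omega>. (norm (iterate (Suc k) \<omega> - mean_step m))\<^sup>2 \<partial>M)"
    unfolding dispersion_def by (rule variance_le_mean_square[OF iterate_square_integrable])
  also have "\<dots> = (\<integral>\<omega>. (norm (W \<omega> + (\<Sum>i<t. Y i \<omega>)))\<^sup>2 \<partial>M)"
    by (simp add: iterate_Suc W_def Y_def algebra_simps)
  also have "\<dots> = (\<integral>\<omega>. (norm (W \<omega>))\<^sup>2 \<partial>M) + (\<Sum>i<t. \<integral>\<omega>. (norm (Y i \<omega>))\<^sup>2 \<partial>M)"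
    by (intro mean_square_orthogonal_sum W) (use Y WY YY in auto)
  also have "\<dots> \<le> (c + h * L)\<^sup>2 * dispersion k + (\<Sum>i<t. (h / real t)\<^sup>2 * \<sigma>\<^sup>2)"
  proof (intro add_mono sum_mono)
    have "(\<integral>\<omega>. (norm (W \<omega>))\<^sup>2 \<partial>M) \<le> (\<integral>\<omega>. (c + h * L)\<^sup>2 * (norm (iterate k \<omega> - m))\<^sup>2 \<partial>M)"
    proof (rule integral_mono)
      show "integrable M (\<lambda>\<omega>. (c + h * L)\<^sup>2 * (norm (iterate k \<omega> - m))\<^sup>2)"
        by (intro integrable_mult_right square_integrable_norm square_integrable_diff
            iterate_square_integrable square_integrable_const)
      show "(norm (W \<omega>))\<^sup>2 \<le> (c + h * L)\<^sup>2 * (norm (iterate k \<omega> - m))\<^sup>2" for \<omega>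
        using power_mono[OF mean_step_lipschitz[of "iterate k \<omega>" m], of 2] by (simp add: W_def power_mult_distrib)
    qed (rule square_integrable_norm[OF W])
    then show "(\<integral>\<omega>. (norm (W \<omega>))\<^sup>2 \<partial>M) \<le> (c + h * L)\<^sup>2 * dispersion k"
      by (simp add: dispersion_def m_def)
  next
    fix i assume "i \<in> {..<t}"
    then have "(h / real t)\<^sup>2 * (\<integral>\<omega>. (norm (noise k i \<omega>))\<^sup>2 \<partial>M) \<le> (h / real t)\<^sup>2 * \<sigma>\<^sup>2"
      by (intro mult_left_mono noise_second_moment) auto
    then show "(\<integral>\<omega>. (norm (Y i \<omega>))\<^sup>2 \<partial>M) \<le> (h / real t)\<^sup>2 * \<sigma>\<^sup>2"
      by (simp add: Y_def power_mult_distrib power_divide)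
  qed
  also have "(\<Sum>i<t. (h / real t)\<^sup>2 * \<sigma>\<^sup>2) = h\<^sup>2 * \<sigma>\<^sup>2 / real t"
    using t_pos by (simp add: power_divide power2_eq_square)
  finally show ?thesis .
qed

text \<open>The right-hand side is the fixed point of the affine recursion, and \<open>dispersion 0 = 0\<close> since the
  starting point is deterministic.\<close>

lemma dispersion_le:
  assumes contr: "c + h * L < 1"
  shows "dispersion k \<le> h\<^sup>2 * \<sigma>\<^sup>2 / (real t * (1 - (c + h * L)\<^sup>2))"
proof (induction k)
  define a where "a = (c + h * L)\<^sup>2"
  have a: "a < 1"
    unfolding a_def using contr c_nonneg h_pos L_nonneg by (simp add: power_less_one_iff abs_square_less_1)
  {
    case 0
    show ?case using prob_space a by (simp add: dispersion_def a_def)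
  next
    case (Suc k)
    have "dispersion (Suc k) \<le> a * (h\<^sup>2 * \<sigma>\<^sup>2 / (real t * (1 - a))) + h\<^sup>2 * \<sigma>\<^sup>2 / real t"
      using dispersion_Suc[of k] mult_left_mono[OF Suc, of a] by (simp add: a_def)
    also have "\<dots> = h\<^sup>2 * \<sigma>\<^sup>2 / (real t * (1 - a))"
      using a t_pos by (simp add: field_simps)
    finally show ?case by (simp add: a_def)
  }
qed

text \<open>The first term is the smoothing bias at the mean, the second is the price for exchanging
  \<open>smooth_grad\<close> and the expectation.\<close>

lemma gradient_of_mean_error:
  "norm (df (\<integral>\<omega>. iterate k \<omega> \<partial>M) - (\<integral>\<omega>. smooth_grad (iterate k \<omega>) \<partial>M))
    \<le> \<mu> / 2 * L * (real CARD('n) + 3) powr (3 / 2) + L * sqrt (dispersion k)"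
proof -
  define m where "m = (\<integral>\<omega>. iterate k \<omega> \<partial>M)"
  have "(norm ((\<integral>\<omega>. smooth_grad (iterate k \<omega>) \<partial>M) - smooth_grad m))\<^sup>2 \<le> (\<integral>\<omega>. (norm (smooth_grad (iterate k \<omega>) - smooth_grad m))\<^sup>2 \<partial>M)"
    by (intro norm_expectation_sq_le square_integrable_lipschitz[OF iterate_square_integrable smooth_grad_lipschitz])
  also have "\<dots> \<le> (\<integral>\<omega>. L\<^sup>2 * (norm (iterate k \<omega> - m))\<^sup>2 \<partial>M)"
  proof (rule integral_mono)
    show "integrable M (\<lambda>\<omega>. (norm (smooth_grad (iterate k \<omega>) - smooth_grad m))\<^sup>2)"
      by (intro square_integrable_norm square_integrable_diff square_integrable_const
          square_integrable_lipschitz[OF iterate_square_integrable smooth_grad_lipschitz])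
    show "integrable M (\<lambda>\<omega>. L\<^sup>2 * (norm (iterate k \<omega> - m))\<^sup>2)"
      by (intro integrable_mult_right square_integrable_norm square_integrable_diff
          iterate_square_integrable square_integrable_const)
    show "(norm (smooth_grad (iterate k \<omega>) - smooth_grad m))\<^sup>2 \<le> L\<^sup>2 * (norm (iterate k \<omega> - m))\<^sup>2" for \<omega>
      using power_mono[OF smooth_grad_lipschitz[of "iterate k \<omega>" m], of 2] by (simp add: power_mult_distrib)
  qed
  also have "\<dots> = L\<^sup>2 * dispersion k"
    by (simp add: dispersion_def m_def)
  finally have "norm ((\<integral>\<omega>. smooth_grad (iterate k \<omega>) \<partial>M) - smooth_grad m) \<le> sqrt (L\<^sup>2 * dispersion k)"
    by (rule real_le_rsqrt)
  also have "\<dots> = L * sqrt (dispersion k)"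
    using L_nonneg by (simp add: real_sqrt_mult)
  finally have "norm (smooth_grad m - (\<integral>\<omega>. smooth_grad (iterate k \<omega>) \<partial>M)) \<le> L * sqrt (dispersion k)"
    by (simp add: norm_minus_commute)
  moreover have "norm (df m - smooth_grad m) \<le> \<mu> / 2 * L * (real CARD('n) + 3) powr (3 / 2)"
    unfolding smooth_grad_def by (rule grad_gaussian_smoothing_bias[OF mu_pos])
  ultimately show ?thesis
    using norm_triangle_ineq[of "df m - smooth_grad m" "smooth_grad m - (\<integral>\<omega>. smooth_grad (iterate k \<omega>) \<partial>M)"] by (simp add: m_def)
qed

end

section \<open>Deviation of the mean iterates from gradient descent\<close>

theorem lemma5:
  fixes f :: "real^'n \<Rightarrow> real"
    and L\<^sub>1 c h \<mu> \<sigma> :: real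
    and t :: nat
    and M :: "'w measure"
    and u :: "nat \<Rightarrow> nat \<Rightarrow> 'w \<Rightarrow> real^'n"
    and z0 :: "real^'n"
    and zt :: "nat \<Rightarrow> 'w \<Rightarrow> real^'n"
    and zbar q :: "nat \<Rightarrow> real^'n"
  assumes f_diff: "\<And>x. f differentiable (at x)"
    and f_C1: "continuous_on UNIV (grad f)"
    and f_bdd: "bdd_below (range f)"
    and L1_pos: "L\<^sub>1 > 0"
    and f_lip: "\<And>x y. norm (grad f x - grad f y) \<le> L\<^sub>1 * norm (x - y)"
    and c: "0 \<le> c" "c < 1"
    and mu_pos: "\<mu> > 0"
    and t_pos: "t \<ge> 1"
    and sigma: "\<sigma> \<ge> 0"
    and variance: "\<And>x. (\<integral>v. (norm (two_point_oracle \<mu> f x v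
                      - grad (gaussian_smoothing \<mu> f) x))\<^sup>2 \<partial>std_gaussian) \<le> \<sigma>\<^sup>2"
    and h: "0 < h" "h < (sqrt (2 * (1 + c\<^sup>2)) - 2 * c) / (2 * L\<^sub>1)"
    and M: "prob_space M"
    and u_distr: "\<And>k i. i < t \<Longrightarrow> distr M borel (u k i) = std_gaussian"
    and u_indep: "prob_space.indep_vars M (\<lambda>_. borel) (\<lambda>(k, i). u k i) (UNIV \<times> {..<t})"
    and zt: "\<And>k \<omega>. zt k \<omega> = zo_iterate \<mu> t c h f z0 (\<lambda>k i. u k i \<omega>) k"
    and zbar: "\<And>k. zbar k = (\<integral>\<omega>. zt k \<omega> \<partial>M)"
    and q: "\<And>k. q k = h *\<^sub>R (grad f (zbar k)
                      - (\<integral>\<omega>. grad (gaussian_smoothing \<mu> f) (zt k \<omega>) \<partial>M))"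
  shows "(\<forall>k. zbar (Suc k) = c *\<^sub>R zbar k - h *\<^sub>R grad f (zbar k) + q k)
    \<and> bdd_above (range (\<lambda>k. norm (q k)))
    \<and> (SUP k. norm (q k))
        \<le> h * (\<mu> / 2) * L\<^sub>1 * (real CARD('n) + 3) powr (3 / 2)
          + h * L\<^sub>1 * sqrt (2 * h\<^sup>2 * \<sigma>\<^sup>2
              / (real t * (1 - c\<^sup>2 - 4 * c * L\<^sub>1 * h - 2 * L\<^sub>1\<^sup>2 * h\<^sup>2)))"
proof -
  interpret prob_space M by (rule M)
  interpret zo_gradient_descent M f "grad f" L\<^sub>1 \<mu> c h \<sigma> t u z0
  proof unfold_locales
    show "GDERIV f x :> grad f x" for x by (rule GDERIV_grad[OF f_diff])
  qed (use assms in auto)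
  have zt_eq: "zt k = iterate k" for k
    by (simp add: fun_eq_iff zt iterate_def)
  define D where "D = 1 - c\<^sup>2 - 4 * c * L\<^sub>1 * h - 2 * L\<^sub>1\<^sup>2 * h\<^sup>2"
  define R where "R = h * (\<mu> / 2) * L\<^sub>1 * (real CARD('n) + 3) powr (3 / 2)
    + h * L\<^sub>1 * sqrt (2 * h\<^sup>2 * \<sigma>\<^sup>2 / (real t * D))"

  \<comment> \<open>The step size condition is equivalent to \<open>D > 0\<close>. The factor 2 in the target bound absorbs the
    difference between \<open>D\<close> and the contraction gap \<open>1 - (c + h L)\<^sup>2\<close>.\<close>
  have "2 * (L\<^sub>1 * h + c) < sqrt (2 * (1 + c\<^sup>2))"
    using h(2) L1_pos by (simp add: field_simps)
  then have "(2 * (L\<^sub>1 * h + c))\<^sup>2 < (sqrt (2 * (1 + c\<^sup>2)))\<^sup>2"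
    using h(1) L1_pos c(1) by (intro power_strict_mono) auto
  then have sq: "2 * (c + h * L\<^sub>1)\<^sup>2 < 1 + c\<^sup>2"
    by (simp add: power2_eq_square algebra_simps)
  have c2: "c\<^sup>2 < 1"
    using c by (simp add: power_less_one_iff abs_square_less_1)
  have D_eq: "D = 1 + c\<^sup>2 - 2 * (c + h * L\<^sub>1)\<^sup>2"
    by (simp add: D_def power2_eq_square algebra_simps)
  have D_pos: "D > 0" and D_le: "D \<le> 2 * (1 - (c + h * L\<^sub>1)\<^sup>2)"
    using sq c2 by (auto simp: D_eq)
  have "(c + h * L\<^sub>1)\<^sup>2 < 1\<^sup>2"
    using sq c2 by simp
  then have contr: "c + h * L\<^sub>1 < 1"
    by (rule power2_less_imp_less) simp

  have disp: "dispersion k \<le> 2 * h\<^sup>2 * \<sigma>\<^sup>2 / (real t * D)" for k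
  proof -
    have twice: "a / (real t * x) = 2 * a / (real t * (2 * x))" for a x :: real
      by simp
    have "dispersion k \<le> 2 * h\<^sup>2 * \<sigma>\<^sup>2 / (real t * (2 * (1 - (c + h * L\<^sub>1)\<^sup>2)))"
      using dispersion_le[OF contr, of k] twice[of "h\<^sup>2 * \<sigma>\<^sup>2" "1 - (c + h * L\<^sub>1)\<^sup>2"]
      by (simp only: mult.assoc)
    also have "\<dots> \<le> 2 * h\<^sup>2 * \<sigma>\<^sup>2 / (real t * D)"
      using D_pos D_le t_pos by (intro divide_left_mono mult_left_mono mult_pos_pos) auto
    finally show ?thesis .
  qed
  have q_le: "norm (q k) \<le> R" for k
  proof -
    have "norm (q k) = h * norm (grad f (\<integral>\<omega>. iterate k \<omega> \<partial>M) - (\<integral>\<omega>. smooth_grad (iterate k \<omega>) \<partial>M))"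
      using h(1) by (simp add: q zbar zt_eq smooth_grad_def)
    also have "\<dots> \<le> h * (\<mu> / 2 * L\<^sub>1 * (real CARD('n) + 3) powr (3 / 2) + L\<^sub>1 * sqrt (dispersion k))"
      using h(1) by (intro mult_left_mono gradient_of_mean_error) simp
    also have "\<dots> \<le> h * (\<mu> / 2 * L\<^sub>1 * (real CARD('n) + 3) powr (3 / 2)
        + L\<^sub>1 * sqrt (2 * h\<^sup>2 * \<sigma>\<^sup>2 / (real t * D)))"
      using h(1) L1_pos disp by (intro mult_left_mono add_left_mono real_sqrt_le_mono) auto
    finally show ?thesis by (simp add: R_def algebra_simps)
  qed
  have "zbar (Suc k) = c *\<^sub>R zbar k - h *\<^sub>R grad f (zbar k) + q k" for k
    using mean_recursion[of k] by (simp add: q zbar zt_eq smooth_grad_def algebra_simps)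
  moreover have "bdd_above (range (\<lambda>k. norm (q k)))"
    using q_le by (intro bdd_aboveI2)
  moreover have "(SUP k. norm (q k)) \<le> R"
    using q_le by (intro cSUP_least) auto
  ultimately show ?thesis
    unfolding R_def D_def by blast
qed

end
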